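(* Let $\mathcal{H}$ be a space of the class $\mathfrak{R}$, with Riesz basis of normalized reproducing kernels at the points $T=\{t_n\}$ and associated weights $\{b_n\}$. If $\sum_n b_n<+\infty$, then there exists an exact system of reproducing kernels $\{k_{\lambda_n}\}$ in $\mathcal{H}$ such that its biorthogonal system is not complete in $\mathcal{H}$.
   Context: A system of vectors $\{v_n\}$ in a Hilbert space $\mathcal{H}$ is complete if its closed linear span is $\mathcal{H}$; it is exact if it is complete and fails to be complete when any one vector is removed. An exact system $\{v_n\}$ has a unique biorthogonal system $\{w_m\}\subset\mathcal{H}$, i.e. $\langle v_n,w_m\rangle=\delta_{nm}$. A Riesz basis is the image of an orthonormal basis under a bounded invertible operator. The class $\mathfrak{R}$ consists of the (separable) Hilbert spaces $\mathcal{H}$ of entire functions such that: (A1) for every $\lambda\in\mathbb{C}$ there is $k_\lambda\in\mathcal{H}$ (the reproducing kernel) with $\langle f,k_\lambda\rangle=f(\lambda)$ for all $f\in\mathcal{H}$; (A2) if $f\in\mathcal{H}$ and $f(w)=0$, then $\frac{f(z)}{z-w}\in\mathcal{H}$; (A3) there is a sequence of distinct points $T=\{t_n\}\subset\mathbb{C}$ such that $\{k_{t_n}/\|k_{t_n}\|_{\mathcal{H}}\}$ is a Riesz basis of $\mathcal{H}$. The sequence $T$ is infinite and is fixed. The generating function $F$ of $T$ is the entire function, unique up to a nonzero multiplicative constant, such that the system biorthogonal to $\{k_{t_n}/\|k_{t_n}\|_{\mathcal{H}}\}$ is $\left\{\frac{\|k_{t_n}\|_{\mathcal{H}}}{F'(t_n)}\cdot\frac{F(z)}{z-t_n}\right\}$.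 The weights are $b_n:=\|k_{t_n}\|_{\mathcal{H}}^2/|F'(t_n)|^2$. *)

theory Defs
  imports "HOL-Complex_Analysis.Complex_Analysis" "HOL-Library.Function_Algebras"
begin

section \<open>Complex Hilbert spaces of functions\<close>

text \<open>
  A Hilbert space of functions is given by its carrier \<open>H\<close> (a set of functions) and an inner
  product \<open>ip\<close>, linear in the first argument, of which only the values on \<open>H \<times> H\<close> matter.
  Addition, subtraction and zero of functions are the pointwise ones of
  \<^theory>\<open>HOL-Library.Function_Algebras\<close>.
\<close>

type_synonym cfun = "complex \<Rightarrow> complex"
type_synonym cinner = "cfun \<Rightarrow> cfun \<Rightarrow> complex"

definition fscale :: "complex \<Rightarrow> cfun \<Rightarrow> cfun" where
  "fscale c f = (\<lambda>z. c * f z)"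

interpretation cfun: vector_space fscale
  by standard (auto simp: fscale_def fun_eq_iff algebra_simps)

definition hnorm :: "cinner \<Rightarrow> cfun \<Rightarrow> real" where
  "hnorm ip f = sqrt (Re (ip f f))"

text \<open>The value off the carrier is irrelevant; it is fixed to 0 because
  \<^locale>\<open>Metric_space\<close> asks for nonnegativity and symmetry on the whole type.\<close>

definition hdist :: "cfun set \<Rightarrow> cinner \<Rightarrow> cfun \<Rightarrow> cfun \<Rightarrow> real" where
  "hdist H ip f g = (if f \<in> H \<and> g \<in> H then hnorm ip (f - g) else 0)"

definition htopology :: "cfun set \<Rightarrow> cinner \<Rightarrow> cfun topology" where
  "htopology H ip = Metric_space.mtopology H (hdist H ip)"

locale inner_product_function_space =
  fixes H :: "cfun set" and ip :: cinner
  assumes subspace: "cfun.subspace H"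
    and ip_add: "\<lbrakk>f \<in> H; g \<in> H; h \<in> H\<rbrakk> \<Longrightarrow> ip (f + g) h = ip f h + ip g h"
    and ip_scale: "\<lbrakk>f \<in> H; g \<in> H\<rbrakk> \<Longrightarrow> ip (fscale c f) g = c * ip f g"
    and ip_cnj: "\<lbrakk>f \<in> H; g \<in> H\<rbrakk> \<Longrightarrow> ip g f = cnj (ip f g)"
    and ip_pos: "\<lbrakk>f \<in> H; f \<noteq> 0\<rbrakk> \<Longrightarrow> 0 < Re (ip f f)"
begin

lemma add_mem: "f \<in> H \<Longrightarrow> g \<in> H \<Longrightarrow> f + g \<in> H"
  and diff_mem: "f \<in> H \<Longrightarrow> g \<in> H \<Longrightarrow> f - g \<in> H"
  and scale_mem: "f \<in> H \<Longrightarrow> fscale c f \<in> H"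
  and zero_mem: "0 \<in> H"
  using subspace
  by (auto intro: cfun.subspace_add cfun.subspace_diff cfun.subspace_scale cfun.subspace_0)

lemma ip_zero: "g \<in> H \<Longrightarrow> ip 0 g = 0"
  using ip_add[of 0 0 g] zero_mem by simp

lemma ip_diff: "f \<in> H \<Longrightarrow> g \<in> H \<Longrightarrow> h \<in> H \<Longrightarrow> ip (f - g) h = ip f h - ip g h"
  using ip_add[of "f - g" g h] diff_mem[of f g] by simp

lemma ip_add_right: "f \<in> H \<Longrightarrow> g \<in> H \<Longrightarrow> h \<in> H \<Longrightarrow> ip h (f + g) = ip h f + ip h g"
  by (metis add_mem complex_cnj_add ip_add ip_cnj)

lemma ip_scale_right: "f \<in> H \<Longrightarrow> g \<in> H \<Longrightarrow> ip g (fscale c f) = cnj c * ip g f"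
  by (metis complex_cnj_mult ip_cnj ip_scale scale_mem)

lemma Re_ip_ge_0: "f \<in> H \<Longrightarrow> 0 \<le> Re (ip f f)"
  using ip_pos[of f] ip_zero[of 0] zero_mem by (cases "f = 0") auto

lemma Re_ip_quadratic:
  assumes "f \<in> H" "g \<in> H"
  shows "Re (ip (f + fscale (complex_of_real s) g) (f + fscale (complex_of_real s) g))
       = Re (ip f f) + 2 * s * Re (ip f g) + s\<^sup>2 * Re (ip g g)"
  using assms ip_cnj[of f g]
  by (simp add: ip_add ip_add_right ip_scale ip_scale_right add_mem scale_mem
      power2_eq_square algebra_simps)

lemma hnorm_sq: "f \<in> H \<Longrightarrow> (hnorm ip f)\<^sup>2 = Re (ip f f)"
  by (simp add: hnorm_def Re_ip_ge_0)

lemma Re_ip_le: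
  assumes "f \<in> H" "g \<in> H"
  shows "Re (ip f g) \<le> hnorm ip f * hnorm ip g"
proof (cases "g = 0")
  case True
  then show ?thesis
    using assms ip_cnj[of f g] ip_cnj[of g f] ip_zero[of f] ip_zero[of 0]
    by (simp add: hnorm_def zero_mem)
next
  case False
  define a b c where "a = Re (ip f f)" and "b = Re (ip f g)" and "c = Re (ip g g)"
  have c: "c > 0" using ip_pos False assms by (simp add: c_def)
  have "0 \<le> a + 2 * (- b / c) * b + (- b / c)\<^sup>2 * c"
    unfolding a_def b_def c_def
    using Re_ip_ge_0 Re_ip_quadratic[OF assms] assms add_mem scale_mem by metis
  also have "\<dots> = a - b\<^sup>2 / c"
    using c by (simp add: field_simps power2_eq_square)
  finally have "b\<^sup>2 \<le> a * c" using c by (simp add: field_simps)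
  then have "b \<le> sqrt (a * c)" by (rule real_le_rsqrt)
  then show ?thesis by (simp add: a_def b_def c_def hnorm_def real_sqrt_mult)
qed

lemma hnorm_ge_0: "f \<in> H \<Longrightarrow> 0 \<le> hnorm ip f"
  by (simp add: hnorm_def Re_ip_ge_0)

lemma hnorm_triangle:
  assumes "f \<in> H" "g \<in> H"
  shows "hnorm ip (f + g) \<le> hnorm ip f + hnorm ip g"
proof (rule power2_le_imp_le)
  have "(hnorm ip (f + g))\<^sup>2 = (hnorm ip f)\<^sup>2 + 2 * Re (ip f g) + (hnorm ip g)\<^sup>2"
    using assms ip_cnj[of f g] by (simp add: hnorm_sq add_mem ip_add ip_add_right)
  also have "\<dots> \<le> (hnorm ip f + hnorm ip g)\<^sup>2"
    using Re_ip_le[OF assms] by (simp add: power2_sum)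
  finally show "(hnorm ip (f + g))\<^sup>2 \<le> (hnorm ip f + hnorm ip g)\<^sup>2" .
qed (use assms hnorm_ge_0 in auto)

lemma hnorm_minus_commute: "f \<in> H \<Longrightarrow> g \<in> H \<Longrightarrow> hnorm ip (f - g) = hnorm ip (g - f)"
  using ip_scale[of "f - g" "g - f" "-1"] ip_scale_right[of "f - g" "f - g" "-1"]
    diff_mem[of f g] diff_mem[of g f]
  by (simp add: hnorm_def fscale_def fun_diff_def)

lemma hnorm_eq_0: "f \<in> H \<Longrightarrow> hnorm ip f = 0 \<longleftrightarrow> f = 0"
  using ip_pos[of f] ip_zero[of 0] zero_mem by (cases "f = 0") (auto simp: hnorm_def)

sublocale Metric_space H "hdist H ip"
proof
  fix f g h
  show "0 \<le> hdist H ip f g" by (simp add: hdist_def hnorm_ge_0 diff_mem)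
  show "hdist H ip f g = hdist H ip g f" by (auto simp: hdist_def hnorm_minus_commute)
  show "hdist H ip f g = 0 \<longleftrightarrow> f = g" if "f \<in> H" "g \<in> H"
    using that by (simp add: hdist_def hnorm_eq_0 diff_mem)
  show "hdist H ip f h \<le> hdist H ip f g + hdist H ip g h"
    if "f \<in> H" "g \<in> H" "h \<in> H"
    using that hnorm_triangle[of "f - g" "g - h"] by (simp add: hdist_def diff_mem)
qed

end

locale hilbert_function_space = inner_product_function_space +
  assumes mcomplete: "mcomplete"
    and separable: "separable_space (htopology H ip)"


section \<open>Complete, exact and biorthogonal systems; Riesz bases\<close>

definition closed_span :: "cfun set \<Rightarrow> cinner \<Rightarrow> cfun set \<Rightarrow> cfun set" where
  "closed_span H ip S = htopology H ip closure_of (cfun.span S)"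

definition complete_system :: "cfun set \<Rightarrow> cinner \<Rightarrow> cfun set \<Rightarrow> bool" where
  "complete_system H ip S \<longleftrightarrow> S \<subseteq> H \<and> closed_span H ip S = H"

text \<open>Exactness concerns the indexed family: removing one index must destroy completeness, so an
  exact family has no repetitions.\<close>

definition exact_system :: "cfun set \<Rightarrow> cinner \<Rightarrow> (nat \<Rightarrow> cfun) \<Rightarrow> bool" where
  "exact_system H ip v \<longleftrightarrow>
     complete_system H ip (range v) \<and> (\<forall>n. \<not> complete_system H ip (v ` (UNIV - {n})))"

definition biorthogonal :: "cfun set \<Rightarrow> cinner \<Rightarrow> (nat \<Rightarrow> cfun) \<Rightarrow> (nat \<Rightarrow> cfun) \<Rightarrow> bool" where
  "biorthogonal H ip v w \<longleftrightarrow>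
     range v \<subseteq> H \<and> range w \<subseteq> H \<and> (\<forall>n m. ip (v n) (w m) = (if n = m then 1 else 0))"

definition orthonormal_basis :: "cfun set \<Rightarrow> cinner \<Rightarrow> (nat \<Rightarrow> cfun) \<Rightarrow> bool" where
  "orthonormal_basis H ip e \<longleftrightarrow>
     complete_system H ip (range e) \<and> (\<forall>n m. ip (e n) (e m) = (if n = m then 1 else 0))"

definition bounded_operator :: "cfun set \<Rightarrow> cinner \<Rightarrow> (cfun \<Rightarrow> cfun) \<Rightarrow> bool" where
  "bounded_operator H ip A \<longleftrightarrow>
     A ` H \<subseteq> H \<and>
     (\<forall>f\<in>H. \<forall>g\<in>H. A (f + g) = A f + A g) \<and>
     (\<forall>c. \<forall>f\<in>H. A (fscale c f) = fscale c (A f)) \<and>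
     (\<exists>C. \<forall>f\<in>H. hnorm ip (A f) \<le> C * hnorm ip f)"

definition bounded_invertible_operator ::
    "cfun set \<Rightarrow> cinner \<Rightarrow> (cfun \<Rightarrow> cfun) \<Rightarrow> bool" where
  "bounded_invertible_operator H ip A \<longleftrightarrow>
     bounded_operator H ip A \<and>
     (\<exists>B. bounded_operator H ip B \<and> (\<forall>f\<in>H. B (A f) = f \<and> A (B f) = f))"

definition riesz_basis :: "cfun set \<Rightarrow> cinner \<Rightarrow> (nat \<Rightarrow> cfun) \<Rightarrow> bool" where
  "riesz_basis H ip v \<longleftrightarrow>
     (\<exists>e A. orthonormal_basis H ip e \<and> bounded_invertible_operator H ip A \<and>
            (\<forall>n. v n = A (e n)))"


section \<open>Reproducing kernels and the class R\<close>

text \<open>The function \<open>f(z) / (z - w)\<close>, for \<open>f\<close> vanishing at \<open>w\<close>, with the removable singularity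
  at \<open>w\<close> filled in.\<close>

definition divide_zero :: "cfun \<Rightarrow> complex \<Rightarrow> cfun" where
  "divide_zero f w = (\<lambda>z. if z = w then deriv f w else f z / (z - w))"

definition is_rep_kernel :: "cfun set \<Rightarrow> cinner \<Rightarrow> complex \<Rightarrow> cfun \<Rightarrow> bool" where
  "is_rep_kernel H ip w k \<longleftrightarrow> k \<in> H \<and> (\<forall>f\<in>H. ip f k = f w)"

definition rep_kernel :: "cfun set \<Rightarrow> cinner \<Rightarrow> complex \<Rightarrow> cfun" where
  "rep_kernel H ip w = (THE k. is_rep_kernel H ip w k)"

lemma (in inner_product_function_space) rep_kernel_eq:
  assumes "is_rep_kernel H ip w k"
  shows "rep_kernel H ip w = k"
  unfolding rep_kernel_def
proof (rule the_equality)
  fix l assume l: "is_rep_kernel H ip w l"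
  have "ip h l = ip h k" if "h \<in> H" for h
    using l assms that by (simp add: is_rep_kernel_def)
  then have "ip (l - k) (l - k) = 0"
    using l assms ip_cnj diff_mem ip_diff unfolding is_rep_kernel_def
    by (metis cancel_comm_monoid_add_class.diff_cancel)
  then show "l = k"
    using l assms ip_pos[of "l - k"] diff_mem[of l k] unfolding is_rep_kernel_def by auto
qed (rule assms)

definition normalized_kernel :: "cfun set \<Rightarrow> cinner \<Rightarrow> complex \<Rightarrow> cfun" where
  "normalized_kernel H ip w =
     fscale (complex_of_real (1 / hnorm ip (rep_kernel H ip w))) (rep_kernel H ip w)"

definition riesz_kernel_points :: "cfun set \<Rightarrow> cinner \<Rightarrow> (nat \<Rightarrow> complex) \<Rightarrow> bool" where
  "riesz_kernel_points H ip t \<longleftrightarrow>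
     inj t \<and> riesz_basis H ip (\<lambda>n. normalized_kernel H ip (t n))"

locale class_R = hilbert_function_space +
  assumes entire: "f \<in> H \<Longrightarrow> f holomorphic_on UNIV"
    and A1: "\<exists>k. is_rep_kernel H ip w k"
    and A2: "\<lbrakk>f \<in> H; f w = 0\<rbrakk> \<Longrightarrow> divide_zero f w \<in> H"
    and A3: "\<exists>t. riesz_kernel_points H ip t"

text \<open>The conditions \<open>F (t n) = 0\<close> and \<open>deriv F (t n) \<noteq> 0\<close> need not be listed: the first is
  forced by the members of the biorthogonal system being continuous at \<open>t n\<close>, the second by
  their being nonzero.\<close>

definition generating_function ::
    "cfun set \<Rightarrow> cinner \<Rightarrow> (nat \<Rightarrow> complex) \<Rightarrow> cfun \<Rightarrow> bool" where
  "generating_function H ip t F \<longleftrightarrow>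
     F holomorphic_on UNIV \<and>
     biorthogonal H ip (\<lambda>n. normalized_kernel H ip (t n))
       (\<lambda>n. fscale (complex_of_real (hnorm ip (rep_kernel H ip (t n))) / deriv F (t n))
              (divide_zero F (t n)))"

definition weight ::
    "cfun set \<Rightarrow> cinner \<Rightarrow> (nat \<Rightarrow> complex) \<Rightarrow> cfun \<Rightarrow> nat \<Rightarrow> real" where
  "weight H ip t F n =
     (hnorm ip (rep_kernel H ip (t n)))\<^sup>2 / (cmod (deriv F (t n)))\<^sup>2"

end

theory Submission
  imports Defs
begin

text \<open>
  Since the weights are summable, the functional
  \<open>f \<mapsto> \<Sum>n. f (t n) / F' (t n)\<close> is bounded on \<open>H\<close>, hence given by some \<open>h \<noteq> 0\<close>. It vanishes on \<open>q\<close>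
  as soon as both \<open>q\<close> and \<open>(z - a) q\<close> belong to \<open>H\<close>, because \<open>f / F = \<Sum>n. f (t n) / F' (t n) / (z - t n)\<close>
  for \<open>f \<in> H\<close>. The points are the zeros of an entire \<open>G = F * (\<Sum>n. c n / (z - t n))\<close>
  with \<open>c\<close> supported on a lacunary set, where \<open>\<bar>c n\<bar>\<^sup>2 = b n\<close> up to one exception. Then \<open>G \<notin> H\<close>, while
  every \<open>G / (z - \<lambda>)\<close> with \<open>G \<lambda> = 0\<close> lies in \<open>H\<close> and is orthogonal to \<open>h\<close>; these functions form, up to
  factors, the biorthogonal system. If \<open>f \<in> H\<close> vanishes at all zeros of \<open>G\<close>, then \<open>f / G\<close> is entire and
  bounded on a sequence of circles between the lacunary points, so it is constant, and \<open>G \<notin> H\<close>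
  forces \<open>f = 0\<close>. A generic choice of the exceptional coefficient makes the zeros of \<open>G\<close> simple.
\<close>

section \<open>Hilbert spaces of functions and Riesz bases\<close>

context inner_product_function_space
begin

lemma ip_zero_right: "g \<in> H \<Longrightarrow> ip g 0 = 0"
  using ip_cnj[of 0 g] ip_zero zero_mem by simp

lemma ip_diff_right: "\<lbrakk>f \<in> H; g \<in> H; h \<in> H\<rbrakk> \<Longrightarrow> ip h (f - g) = ip h f - ip h g"
  using ip_add_right[of "f - g" g h] diff_mem[of f g] by simp

lemma sum_mem: "(\<And>i. i \<in> I \<Longrightarrow> u i \<in> H) \<Longrightarrow> sum u I \<in> H"
  using cfun.subspace_sum[OF subspace] by blast

lemma ip_sum:
  assumes "\<And>i. i \<in> I \<Longrightarrow> u i \<in> H" "x \<in> H"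
  shows "ip (\<Sum>i\<in>I. fscale (a i) (u i)) x = (\<Sum>i\<in>I. a i * ip (u i) x)"
  using assms
proof (induction I rule: infinite_finite_induct)
  case (insert j I)
  then have "ip (fscale (a j) (u j) + (\<Sum>i\<in>I. fscale (a i) (u i))) x
      = a j * ip (u j) x + (\<Sum>i\<in>I. a i * ip (u i) x)"
    by (subst ip_add) (auto simp: ip_scale scale_mem sum_mem)
  then show ?case
    unfolding sum.insert[OF insert.hyps] .
qed (simp_all add: ip_zero)

lemma ip_sum_right:
  assumes "\<And>i. i \<in> I \<Longrightarrow> u i \<in> H" "x \<in> H"
  shows "ip x (\<Sum>i\<in>I. fscale (a i) (u i)) = (\<Sum>i\<in>I. cnj (a i) * ip x (u i))"
  using assms
proof (induction I rule: infinite_finite_induct)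
  case (insert j I)
  then have "ip x (fscale (a j) (u j) + (\<Sum>i\<in>I. fscale (a i) (u i)))
      = cnj (a j) * ip x (u j) + (\<Sum>i\<in>I. cnj (a i) * ip x (u i))"
    by (subst ip_add_right) (auto simp: ip_scale_right scale_mem sum_mem)
  then show ?case
    unfolding sum.insert[OF insert.hyps] .
qed (simp_all add: ip_zero_right)

lemma ip_self: "f \<in> H \<Longrightarrow> ip f f = complex_of_real ((hnorm ip f)\<^sup>2)"
  using ip_cnj[of f f] by (simp add: complex_eq_iff hnorm_sq)

lemma hnorm_scale: "f \<in> H \<Longrightarrow> hnorm ip (fscale c f) = cmod c * hnorm ip f"
proof -
  assume f: "f \<in> H"
  have "ip (fscale c f) (fscale c f) = (c * cnj c) * ip f f"
    using f by (simp add: ip_scale ip_scale_right scale_mem)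
  also have "\<dots> = complex_of_real ((cmod c * hnorm ip f)\<^sup>2)"
    using f by (simp add: ip_self power_mult_distrib complex_norm_square[symmetric])
  finally show ?thesis
    using hnorm_ge_0[OF f] by (simp add: hnorm_def[of _ "fscale c f"])
qed

lemma cmod_ip_le:
  assumes "f \<in> H" "g \<in> H"
  shows "cmod (ip f g) \<le> hnorm ip f * hnorm ip g"
proof (cases "ip f g = 0")
  case True
  then show ?thesis using assms by (simp add: hnorm_ge_0)
next
  case False
  \<comment> \<open>Rotating \<open>f\<close> by this unimodular factor makes the inner product real
    and nonnegative, so the bound on real parts applies.\<close>
  define c where "c = cnj (sgn (ip f g))"
  have "c * ip f g = complex_of_real (cmod (ip f g))"
    using False unfolding c_def sgn_eq
    by (simp add: field_simps complex_norm_square[symmetric] power2_eq_square)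
  then have "cmod (ip f g) = Re (ip (fscale c f) g)"
    using assms by (simp add: ip_scale)
  also have "\<dots> \<le> hnorm ip (fscale c f) * hnorm ip g"
    using assms by (simp add: Re_ip_le scale_mem)
  also have "\<dots> = hnorm ip f * hnorm ip g"
    using assms False by (simp add: hnorm_scale c_def norm_sgn)
  finally show ?thesis .
qed

lemma span_subset: "S \<subseteq> H \<Longrightarrow> cfun.span S \<subseteq> H"
  by (simp add: cfun.span_minimal subspace)

lemma closed_span_iff:
  assumes "S \<subseteq> H"
  shows "x \<in> closed_span H ip S \<longleftrightarrow>
    x \<in> H \<and> (\<forall>e>0. \<exists>y\<in>cfun.span S. hnorm ip (x - y) < e)"
proof -
  have Y: "y \<in> H" if "y \<in> cfun.span S" for y using that span_subset[OF assms] by blast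
  have "(\<exists>y\<in>cfun.span S. y \<in> mball x e) \<longleftrightarrow> (\<exists>y\<in>cfun.span S. hnorm ip (x - y) < e)"
    if "x \<in> H" for e
    using that Y by (intro bex_cong) (simp_all add: hdist_def)
  then show ?thesis
    unfolding closed_span_def htopology_def metric_closure_of by blast
qed

text \<open>The vectors orthogonal to \<open>h\<close> form a subspace, and Cauchy-Schwarz carries
  orthogonality over to limits.\<close>

lemma orthogonal_closed_span:
  assumes S: "S \<subseteq> H" and h: "h \<in> H" and orth: "\<And>f. f \<in> S \<Longrightarrow> ip f h = 0"
    and x: "x \<in> closed_span H ip S"
  shows "ip x h = 0"
proof -
  have "cfun.span S \<subseteq> {y \<in> H. ip y h = 0}"
  proof (rule cfun.span_minimal)
    show "S \<subseteq> {y \<in> H. ip y h = 0}" using S orth by blast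
    show "cfun.subspace {y \<in> H. ip y h = 0}"
      using h by (intro cfun.subspaceI) (simp_all add: zero_mem add_mem scale_mem ip_zero ip_add ip_scale)
  qed
  then have span0: "ip y h = 0" if "y \<in> cfun.span S" for y using that by blast
  have "cmod (ip x h) \<le> e * hnorm ip h" if "e > 0" for e
  proof -
    obtain y where y: "y \<in> cfun.span S" "hnorm ip (x - y) < e"
      using x closed_span_iff[OF S, of x] \<open>e > 0\<close> by blast
    have mem: "x \<in> H" "y \<in> H" using x y closed_span_iff[OF S, of x] span_subset[OF S] by blast+
    have "ip x h = ip (x - y) h" using mem h span0[OF y(1)] by (simp add: ip_diff)
    then have "cmod (ip x h) \<le> hnorm ip (x - y) * hnorm ip h"
      using cmod_ip_le[of "x - y" h] mem h by (simp add: diff_mem)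
    also have "\<dots> \<le> e * hnorm ip h" using y h by (intro mult_right_mono) (auto simp: hnorm_ge_0)
    finally show ?thesis .
  qed
  moreover have "((\<lambda>e. e * hnorm ip h) \<longlongrightarrow> 0 * hnorm ip h) (at_right 0)"
    by (intro tendsto_intros)
  ultimately have "cmod (ip x h) \<le> 0 * hnorm ip h"
    by (intro tendsto_lowerbound[of "\<lambda>e. e * hnorm ip h" _ "at_right 0"])
      (auto simp: eventually_at_right_field intro: exI[of _ 1])
  then show ?thesis by simp
qed

text \<open>The closed span contains \<open>h\<close> itself, which is then orthogonal to itself.
  Used contrapositively, a nonzero \<open>h\<close> detects incompleteness.\<close>

lemma complete_system_orthogonal:
  assumes "complete_system H ip S" "h \<in> H" "\<And>f. f \<in> S \<Longrightarrow> ip f h = 0"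
  shows "h = 0"
proof -
  have "ip h h = 0"
    using assms orthogonal_closed_span[of S h h] by (simp add: complete_system_def)
  then show ?thesis using ip_pos[of h] assms(2) by auto
qed

lemma parallelogram:
  assumes "f \<in> H" "g \<in> H"
  shows "(hnorm ip (f + g))\<^sup>2 + (hnorm ip (f - g))\<^sup>2 = 2 * (hnorm ip f)\<^sup>2 + 2 * (hnorm ip g)\<^sup>2"
  using assms
  by (simp add: hnorm_sq add_mem diff_mem ip_add ip_diff ip_add_right ip_diff_right)

lemma ip_tendsto_left:
  assumes x: "x \<in> H" and y: "\<And>n. y n \<in> H" and lim: "(\<lambda>n. hnorm ip (y n - x)) \<longlonglongrightarrow> 0"
    and z: "z \<in> H"
  shows "(\<lambda>n. ip (y n) z) \<longlonglongrightarrow> ip x z"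
proof -
  have "\<forall>\<^sub>F n in sequentially. cmod (ip (y n) z - ip x z) \<le> hnorm ip (y n - x) * hnorm ip z"
    using cmod_ip_le[of "y n - x" z for n] x y z by (simp add: ip_diff diff_mem)
  moreover have "(\<lambda>n. hnorm ip (y n - x) * hnorm ip z) \<longlonglongrightarrow> 0"
    using tendsto_mult_right[OF lim, of "hnorm ip z"] by simp
  ultimately have "(\<lambda>n. ip (y n) z - ip x z) \<longlonglongrightarrow> 0"
    by (rule Lim_null_comparison)
  then show ?thesis by (simp add: LIM_zero_iff)
qed

end

section \<open>Metric completeness and orthogonal projection\<close>

context hilbert_function_space
begin

lemma hnorm_Cauchy_convergent:
  assumes y: "\<And>n. y n \<in> H"
    and cauchy: "\<And>e. e > 0 \<Longrightarrow> \<exists>N. \<forall>n\<ge>N. \<forall>m\<ge>N. hnorm ip (y n - y m) < e"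
  obtains x where "x \<in> H" "(\<lambda>n. hnorm ip (y n - x)) \<longlonglongrightarrow> 0"
proof -
  have "MCauchy y"
    unfolding MCauchy_def
  proof (intro conjI allI impI)
    show "range y \<subseteq> H" using y by blast
  next
    fix e :: real assume "e > 0"
    then show "\<exists>N. \<forall>n n'. N \<le> n \<longrightarrow> N \<le> n' \<longrightarrow> hdist H ip (y n) (y n') < e"
      using cauchy[of e] y by (simp add: hdist_def)
  qed
  then obtain x where x: "limitin mtopology y x sequentially"
    using mcomplete unfolding mcomplete_def by blast
  then have xH: "x \<in> H" by (simp add: limitin_mspace)
  have "(\<lambda>n. hnorm ip (y n - x)) \<longlonglongrightarrow> 0"
    using x y xH by (simp add: limitin_metric_dist_null hdist_def)
  then show thesis using that xH by blast
qed

text \<open>The projection theorem: a minimizing sequence for the distance from \<open>x\<close> to the span of \<open>S\<close>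
  is Cauchy, and \<open>x\<close> minus its limit is orthogonal to \<open>S\<close>.\<close>

lemma complete_systemI:
  assumes S: "S \<subseteq> H" and orth: "\<And>f. f \<in> H \<Longrightarrow> (\<And>g. g \<in> S \<Longrightarrow> ip g f = 0) \<Longrightarrow> f = 0"
  shows "complete_system H ip S"
  unfolding complete_system_def
proof (intro conjI set_eqI iffI)
  fix x assume x: "x \<in> H"
  let ?Y = "cfun.span S"
  have YH: "y \<in> H" if "y \<in> ?Y" for y using that span_subset[OF S] by auto
  define d where "d = (INF y\<in>?Y. (hnorm ip (x - y))\<^sup>2)"
  have bdd: "bdd_below ((\<lambda>y. (hnorm ip (x - y))\<^sup>2) ` ?Y)" by (auto intro: bdd_belowI2[of _ 0])
  have d_le: "d \<le> (hnorm ip (x - y))\<^sup>2" if "y \<in> ?Y" for y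
    unfolding d_def using bdd that by (rule cINF_lower)
  have "\<exists>y\<in>?Y. (hnorm ip (x - y))\<^sup>2 < d + inverse (real (Suc n))" for n
    using cINF_less_iff[OF _ bdd, of "d + inverse (real (Suc n))"] cfun.span_zero
    by (auto simp: d_def)
  then obtain y where y: "\<And>n. y n \<in> ?Y"
    and y_less: "\<And>n. (hnorm ip (x - y n))\<^sup>2 < d + inverse (real (Suc n))" by metis
  have yH: "y n \<in> H" for n using y YH by blast
  have dist: "(hnorm ip (y n - y m))\<^sup>2 \<le> 2 * inverse (real (Suc n)) + 2 * inverse (real (Suc m))"
    for n m
  proof -
    \<comment> \<open>The midpoint stays in the span, so its squared distance to \<open>x\<close> is
      at least \<open>d\<close>; the parallelogram law turns this into smallness of
      \<open>y n - y m\<close>.\<close>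
    define mid where "mid = fscale (1/2) (y n + y m)"
    have mid: "mid \<in> ?Y" unfolding mid_def by (intro cfun.span_scale cfun.span_add y)
    have e1: "(x - y m) + (x - y n) = fscale 2 (x - mid)"
      by (auto simp: mid_def fscale_def fun_eq_iff algebra_simps)
    have e2: "(x - y m) - (x - y n) = y n - y m" by simp
    have "4 * (hnorm ip (x - mid))\<^sup>2 + (hnorm ip (y n - y m))\<^sup>2
        = 2 * (hnorm ip (x - y m))\<^sup>2 + 2 * (hnorm ip (x - y n))\<^sup>2"
      using parallelogram[OF diff_mem[OF x yH] diff_mem[OF x yH], of m n]
        hnorm_scale[of "x - mid" 2] diff_mem[OF x YH[OF mid]]
      unfolding e1 e2 by (simp add: power_mult_distrib)
    then show ?thesis using d_le[OF mid] y_less[of n] y_less[of m] by linarith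
  qed
  have "\<exists>N. \<forall>n\<ge>N. \<forall>m\<ge>N. hnorm ip (y n - y m) < e" if e: "e > 0" for e
  proof -
    obtain N where N: "inverse (real (Suc N)) < e\<^sup>2 / 4"
      using reals_Archimedean[of "e\<^sup>2 / 4"] e by auto
    have "hnorm ip (y n - y m) < e" if "n \<ge> N" "m \<ge> N" for n m
    proof (rule power_less_imp_less_base[where n = 2])
      have "inverse (real (Suc n)) \<le> inverse (real (Suc N))"
           "inverse (real (Suc m)) \<le> inverse (real (Suc N))"
        using that by (auto intro!: le_imp_inverse_le)
      then show "(hnorm ip (y n - y m))\<^sup>2 < e\<^sup>2" using dist[of n m] N by linarith
    qed (use e in auto)
    then show ?thesis by blast
  qed
  then obtain p where p: "p \<in> H" and lim: "(\<lambda>n. hnorm ip (y n - p)) \<longlonglongrightarrow> 0"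
    using hnorm_Cauchy_convergent[of y] yH by blast
  have real_part: "Re (ip (x - p) g) = 0" if g: "g \<in> ?Y" for g
  proof -
    have gH: "g \<in> H" using g YH by blast
    \<comment> \<open>Moving \<open>y n\<close> by a multiple of \<open>g\<close> stays in the span
      and cannot bring the squared distance below \<open>d\<close>; the excess of \<open>y n\<close>
      over \<open>d\<close> disappears in the limit.\<close>
    have quad: "0 \<le> 2 * s * Re (ip (x - p) g) + s\<^sup>2 * (hnorm ip g)\<^sup>2" for s
    proof -
      have le: "0 \<le> inverse (real (Suc n)) + (2 * s * Re (ip (x - y n) g) + s\<^sup>2 * (hnorm ip g)\<^sup>2)"
        for n
      proof -
        let ?z = "y n - fscale (complex_of_real s) g"
        have "?z \<in> ?Y" by (intro cfun.span_diff cfun.span_scale y g)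
        then have "d \<le> (hnorm ip (x - ?z))\<^sup>2" by (rule d_le)
        also have "x - ?z = (x - y n) + fscale (complex_of_real s) g" by simp
        also have "(hnorm ip \<dots>)\<^sup>2 = (hnorm ip (x - y n))\<^sup>2 + 2 * s * Re (ip (x - y n) g)
            + s\<^sup>2 * (hnorm ip g)\<^sup>2"
          using Re_ip_quadratic[of "x - y n" g s] x yH gH
          by (simp add: hnorm_sq add_mem diff_mem scale_mem)
        finally show ?thesis using y_less[of n] by linarith
      qed
      have "(\<lambda>n. ip (y n) g) \<longlonglongrightarrow> ip p g" using ip_tendsto_left[OF p yH lim gH] .
      then have "(\<lambda>n. ip (x - y n) g) \<longlonglongrightarrow> ip (x - p) g"
        using x yH p gH by (simp add: ip_diff tendsto_diff)
      then have "(\<lambda>n. inverse (real (Suc n)) + (2 * s * Re (ip (x - y n) g) + s\<^sup>2 * (hnorm ip g)\<^sup>2))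
          \<longlonglongrightarrow> 0 + (2 * s * Re (ip (x - p) g) + s\<^sup>2 * (hnorm ip g)\<^sup>2)"
        by (intro tendsto_intros LIMSEQ_inverse_real_of_nat tendsto_Re)
      then show ?thesis using le by (auto intro: LIMSEQ_le_const)
    qed
    define a b where "a = Re (ip (x - p) g)" and "b = (hnorm ip g)\<^sup>2"
    have "b \<ge> 0" by (simp add: b_def)
    \<comment> \<open>The quadratic is tested at \<open>s = -q\<close>. The added 1 keeps the
      denominator positive when \<open>g\<close> is 0.\<close>
    define q where "q = a / (b + 1)"
    have a: "a = q * (b + 1)" using \<open>b \<ge> 0\<close> by (simp add: q_def)
    have "0 \<le> 2 * (- q) * a + (- q)\<^sup>2 * b"
      using quad unfolding a_def b_def .
    also have "\<dots> = - (q\<^sup>2 * (b + 2))"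
      by (simp add: a algebra_simps power2_eq_square)
    finally have "q = 0" using \<open>b \<ge> 0\<close> by (simp add: mult_le_0_iff)
    then have "a = 0" using a by simp
    then show ?thesis by (simp add: a_def)
  qed
  have "ip g (x - p) = 0" if g: "g \<in> S" for g
  proof -
    have gY: "g \<in> ?Y" using g by (rule cfun.span_base)
    \<comment> \<open>Replacing \<open>g\<close> by \<open>i g\<close> turns the real part into the
      imaginary part.\<close>
    have "Re (ip (x - p) (fscale \<i> g)) = 0" by (intro real_part cfun.span_scale gY)
    then have "Im (ip (x - p) g) = 0"
      using x p YH[OF gY] by (simp add: ip_scale_right diff_mem)
    then have "ip (x - p) g = 0" using real_part[OF gY] by (simp add: complex_eq_iff)
    then show ?thesis using ip_cnj[of "x - p" g] x p YH[OF gY] by (simp add: diff_mem)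
  qed
  then have "x - p = 0" by (intro orth diff_mem x p)
  then have [simp]: "p = x" by simp
  have "\<exists>z\<in>?Y. hnorm ip (x - z) < e" if "e > 0" for e
  proof -
    have "\<forall>\<^sub>F n in sequentially. hnorm ip (y n - x) < e"
      using order_tendstoD(2)[OF lim \<open>e > 0\<close>] by simp
    then obtain n where "hnorm ip (y n - x) < e" by (auto simp: eventually_sequentially)
    then show ?thesis using y x yH by (metis hnorm_minus_commute)
  qed
  then show "x \<in> closed_span H ip S" using x closed_span_iff[OF S] by blast
qed (use S closed_span_iff in auto)

end

section \<open>Coefficient bounds for Riesz bases and their biorthogonal systems\<close>

lemma span_range_explicit:
  fixes v :: "nat \<Rightarrow> cfun"
  assumes "y \<in> cfun.span (range v)"
  obtains J b where "finite J" "y = (\<Sum>j\<in>J. fscale (b j) (v j))"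
  using assms
proof (induction arbitrary: thesis rule: cfun.span_induct_alt)
  case base
  show ?case by (rule base[of "{}" "\<lambda>_. 0"]) auto
next
  case (step c x y)
  obtain n where n: "x = v n" using step.hyps by auto
  obtain J b where J: "finite J" "y = (\<Sum>j\<in>J. fscale (b j) (v j))" using step.IH by blast
  \<comment> \<open>The new index may already belong to \<open>J\<close>; then \<open>c\<close> is
    added to the old coefficient.\<close>
  define b' where "b' = (\<lambda>j. (if j \<in> J then b j else 0) + (if j = n then c else 0))"
  have "(\<Sum>j\<in>insert n J. fscale (b' j) (v j))
      = (\<Sum>j\<in>insert n J. fscale (if j \<in> J then b j else 0) (v j))
        + (\<Sum>j\<in>insert n J. fscale (if j = n then c else 0) (v j))"
    unfolding b'_def cfun.scale_left_distrib sum.distrib ..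
  also have "(\<Sum>j\<in>insert n J. fscale (if j \<in> J then b j else 0) (v j)) = y"
    unfolding J(2) using J(1) by (intro sum.mono_neutral_cong_right) auto
  also have "(\<Sum>j\<in>insert n J. fscale (if j = n then c else 0) (v j)) = (\<Sum>j\<in>{n}. fscale c (v j))"
    using J(1) by (intro sum.mono_neutral_cong_right) auto
  finally show ?case
    using J(1) n by (intro step.prems[of "insert n J" b']) (auto simp: add.commute)
qed

context inner_product_function_space
begin

lemma hnorm_sum_orthonormal:
  fixes e :: "nat \<Rightarrow> cfun"
  assumes e: "\<And>n. e n \<in> H" and on: "\<And>n m. ip (e n) (e m) = (if n = m then 1 else 0)"
    and I: "finite I"
  shows "(hnorm ip (\<Sum>i\<in>I. fscale (a i) (e i)))\<^sup>2 = (\<Sum>i\<in>I. (cmod (a i))\<^sup>2)"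
proof -
  let ?s = "\<Sum>i\<in>I. fscale (a i) (e i)"
  have s: "?s \<in> H" by (intro sum_mem scale_mem e)
  have "ip ?s ?s = (\<Sum>i\<in>I. a i * (\<Sum>j\<in>I. cnj (a j) * ip (e i) (e j)))"
    unfolding ip_sum[OF e s] ip_sum_right[OF e e] ..
  also have "\<dots> = (\<Sum>i\<in>I. a i * cnj (a i))"
    using I by (intro sum.cong) (simp_all add: on if_distrib cong: if_cong)
  also have "\<dots> = complex_of_real (\<Sum>i\<in>I. (cmod (a i))\<^sup>2)"
    by (simp add: complex_norm_square del: of_real_power)
  finally show ?thesis using s by (simp add: hnorm_sq)
qed

lemma bounded_operator_zero: "bounded_operator H ip A \<Longrightarrow> A 0 = 0"
  unfolding bounded_operator_def using zero_mem by (metis add_0 add_right_imp_eq)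

lemma bounded_operator_sum:
  assumes A: "bounded_operator H ip A" and u: "\<And>i. i \<in> I \<Longrightarrow> u i \<in> H"
  shows "A (\<Sum>i\<in>I. fscale (a i) (u i)) = (\<Sum>i\<in>I. fscale (a i) (A (u i)))"
  using u
proof (induction I rule: infinite_finite_induct)
  case (insert j I)
  have "A (fscale (a j) (u j) + (\<Sum>i\<in>I. fscale (a i) (u i)))
      = fscale (a j) (A (u j)) + (\<Sum>i\<in>I. fscale (a i) (A (u i)))"
    using A insert unfolding bounded_operator_def by (simp add: scale_mem sum_mem)
  then show ?case unfolding sum.insert[OF insert.hyps] .
qed (simp_all add: bounded_operator_zero[OF A])

lemma bounded_operator_pos_bound:
  assumes A: "bounded_operator H ip A"
  obtains C where "C > 0" "\<And>f. f \<in> H \<Longrightarrow> hnorm ip (A f) \<le> C * hnorm ip f"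
proof -
  obtain C where C: "\<And>f. f \<in> H \<Longrightarrow> hnorm ip (A f) \<le> C * hnorm ip f"
    using A unfolding bounded_operator_def by blast
  have "hnorm ip (A f) \<le> max 1 C * hnorm ip f" if "f \<in> H" for f
    using C[OF that] mult_right_mono[of C "max 1 C" "hnorm ip f"] hnorm_ge_0[OF that] by simp
  then show thesis using that[of "max 1 C"] by simp
qed

lemma bounded_operator_span:
  assumes A: "bounded_operator H ip A" and S: "S \<subseteq> H" and y: "y \<in> cfun.span S"
  shows "A y \<in> cfun.span (A ` S)"
proof -
  obtain I a where I: "finite I" "I \<subseteq> S" and y_eq: "y = (\<Sum>i\<in>I. fscale (a i) i)"
    using y unfolding cfun.span_explicit by blast
  have "A y = (\<Sum>i\<in>I. fscale (a i) (A i))"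
    unfolding y_eq using I S by (intro bounded_operator_sum[OF A]) blast
  also have "\<dots> \<in> cfun.span (A ` S)"
    using I by (intro cfun.span_sum cfun.span_scale cfun.span_base) blast
  finally show ?thesis .
qed

text \<open>Everything is transported from the orthonormal basis: \<open>A\<close> gives density and
  the upper bound, its inverse the lower bound. The sum of the squared operator bounds serves as a
  common constant.\<close>

lemma riesz_basis_bounds:
  assumes "riesz_basis H ip v"
  obtains C where "C > 0" "complete_system H ip (range v)"
    "\<And>I a. finite I \<Longrightarrow>
      (hnorm ip (\<Sum>i\<in>I. fscale (a i) (v i)))\<^sup>2 \<le> C * (\<Sum>i\<in>I. (cmod (a i))\<^sup>2)"
    "\<And>I a. finite I \<Longrightarrow>
      (\<Sum>i\<in>I. (cmod (a i))\<^sup>2) \<le> C * (hnorm ip (\<Sum>i\<in>I. fscale (a i) (v i)))\<^sup>2"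
proof -
  obtain e A B where onb: "orthonormal_basis H ip e" and A: "bounded_operator H ip A"
    and B: "bounded_operator H ip B" and BA: "\<And>f. f \<in> H \<Longrightarrow> B (A f) = f"
    and AB: "\<And>f. f \<in> H \<Longrightarrow> A (B f) = f" and v: "\<And>n. v n = A (e n)"
    using assms unfolding riesz_basis_def bounded_invertible_operator_def by metis
  have e: "e n \<in> H" and on: "ip (e n) (e m) = (if n = m then 1 else 0)" for n m
    using onb unfolding orthonormal_basis_def complete_system_def by auto
  have AH: "A f \<in> H" and BH: "B f \<in> H" if "f \<in> H" for f
    using A B that unfolding bounded_operator_def by auto
  obtain C1 where C1: "C1 > 0" "\<And>f. f \<in> H \<Longrightarrow> hnorm ip (A f) \<le> C1 * hnorm ip f"
    using bounded_operator_pos_bound[OF A] by blast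
  obtain C2 where C2: "C2 > 0" "\<And>f. f \<in> H \<Longrightarrow> hnorm ip (B f) \<le> C2 * hnorm ip f"
    using bounded_operator_pos_bound[OF B] by blast
  define C where "C = C1\<^sup>2 + C2\<^sup>2"
  show thesis
  proof
    show "C > 0" using C1 C2 by (simp add: C_def add_pos_pos)
    have range_e: "range e \<subseteq> H" and range_v: "range v \<subseteq> H" using e AH v by auto
    have "x \<in> closed_span H ip (range v)" if x: "x \<in> H" for x
      unfolding closed_span_iff[OF range_v]
    proof (intro conjI allI impI x)
      fix r :: real assume r: "r > 0"
      have "B x \<in> closed_span H ip (range e)"
        using onb BH[OF x] unfolding orthonormal_basis_def complete_system_def by simp
      then obtain y where y: "y \<in> cfun.span (range e)" "hnorm ip (B x - y) < r / C1"
        unfolding closed_span_iff[OF range_e] using r C1 by (meson divide_pos_pos)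
      have yH: "y \<in> H" using y span_subset[OF range_e] by auto
      have "A (B x - y) + A y = A (B x)"
        using A BH[OF x] yH diff_mem[of "B x" y] unfolding bounded_operator_def
        by (metis diff_add_cancel)
      then have "x - A y = A (B x - y)" using AB[OF x] by (metis add_diff_cancel_right')
      then have "hnorm ip (x - A y) \<le> C1 * hnorm ip (B x - y)"
        using C1 BH x yH by (simp add: diff_mem)
      also have "\<dots> < C1 * (r / C1)" using y C1 by (intro mult_strict_left_mono) auto
      also have "\<dots> = r" using C1 by simp
      finally have "hnorm ip (x - A y) < r" .
      moreover have "A ` range e = range v" using v by auto
      then have "A y \<in> cfun.span (range v)" using bounded_operator_span[OF A range_e y(1)] by simp
      ultimately show "\<exists>y\<in>cfun.span (range v). hnorm ip (x - y) < r" by blast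
    qed
    then show "complete_system H ip (range v)"
      using range_v closed_span_iff[OF range_v] unfolding complete_system_def by blast
  next
    fix I a assume I: "finite (I :: nat set)"
    let ?s = "\<Sum>i\<in>I. fscale (a i) (e i)" and ?t = "\<Sum>i\<in>I. fscale (a i) (v i)"
    have s: "?s \<in> H" by (intro sum_mem scale_mem e)
    have As: "A ?s = ?t" using bounded_operator_sum[OF A, of I e a] e v by simp
    have Bt: "B ?t = ?s" using BA[OF s] As by simp
    have t: "?t \<in> H" using AH[OF s] As by simp
    have sq: "(hnorm ip ?s)\<^sup>2 = (\<Sum>i\<in>I. (cmod (a i))\<^sup>2)"
      by (rule hnorm_sum_orthonormal[OF e on I])
    have "(hnorm ip ?t)\<^sup>2 \<le> (C1 * hnorm ip ?s)\<^sup>2"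
      using C1(2)[OF s] hnorm_ge_0[OF t] unfolding As by (intro power_mono) auto
    also have "\<dots> \<le> C * (hnorm ip ?s)\<^sup>2"
      by (simp add: power_mult_distrib C_def mult_right_mono)
    finally show "(hnorm ip ?t)\<^sup>2 \<le> C * (\<Sum>i\<in>I. (cmod (a i))\<^sup>2)" by (simp add: sq)
    have "(hnorm ip ?s)\<^sup>2 \<le> (C2 * hnorm ip ?t)\<^sup>2"
      using C2(2)[OF t] hnorm_ge_0[OF s] unfolding Bt by (intro power_mono) auto
    also have "\<dots> \<le> C * (hnorm ip ?t)\<^sup>2"
      by (simp add: power_mult_distrib C_def mult_right_mono)
    finally show "(\<Sum>i\<in>I. (cmod (a i))\<^sup>2) \<le> C * (hnorm ip ?t)\<^sup>2" by (simp add: sq)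
  qed
qed

text \<open>Testing \<open>f\<close> against the combination whose coefficients are its own inner
  products gives \<open>S\<close> as an inner product, so \<open>S^2\<close> is at most a constant
  times \<open>S\<close>, and one factor cancels.\<close>

lemma bessel_summable:
  assumes u: "\<And>n. u n \<in> H" and C: "C \<ge> 0"
    and bound: "\<And>I a. finite I \<Longrightarrow>
      (hnorm ip (\<Sum>i\<in>I. fscale (a i) (u i)))\<^sup>2 \<le> C * (\<Sum>i\<in>I. (cmod (a i))\<^sup>2)"
    and f: "f \<in> H"
  shows "summable (\<lambda>n. (cmod (ip f (u n)))\<^sup>2)"
proof (rule summableI_nonneg_bounded)
  fix N
  define S where "S = (\<Sum>i<N. (cmod (ip f (u i)))\<^sup>2)"
  let ?g = "\<Sum>i<N. fscale (ip f (u i)) (u i)"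
  have S: "S \<ge> 0" unfolding S_def by (simp add: sum_nonneg)
  have g: "?g \<in> H" by (intro sum_mem scale_mem u)
  have "ip f ?g = (\<Sum>i<N. cnj (ip f (u i)) * ip f (u i))"
    using f u by (simp add: ip_sum_right)
  also have "\<dots> = complex_of_real S"
    unfolding S_def by (simp add: complex_norm_square mult.commute del: of_real_power)
  finally have "S = cmod (ip f ?g)" using S by simp
  then have "S \<le> hnorm ip f * hnorm ip ?g" using cmod_ip_le[OF f g] by simp
  then have "S\<^sup>2 \<le> (hnorm ip f)\<^sup>2 * (hnorm ip ?g)\<^sup>2"
    using S by (metis power_mono power_mult_distrib)
  also have "\<dots> \<le> (hnorm ip f)\<^sup>2 * (C * S)"
    unfolding S_def by (intro mult_left_mono bound) auto
  finally have "S * S \<le> (C * (hnorm ip f)\<^sup>2) * S" by (simp add: power2_eq_square ac_simps)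
  then show "S \<le> C * (hnorm ip f)\<^sup>2"
    using S C by (cases "S = 0") (auto simp: mult_le_cancel_right)
qed auto

text \<open>The coefficient map of \<open>v\<close> is bounded on the span of \<open>v\<close>, which is dense, so its adjoint,
  the synthesis map of \<open>w\<close>, is bounded as well.\<close>

lemma biorthogonal_upper_bound:
  assumes complete: "complete_system H ip (range v)" and bio: "biorthogonal H ip v w"
    and C: "C \<ge> 0"
    and bound: "\<And>I a. finite I \<Longrightarrow>
      (\<Sum>i\<in>I. (cmod (a i))\<^sup>2) \<le> C * (hnorm ip (\<Sum>i\<in>I. fscale (a i) (v i)))\<^sup>2"
    and I: "finite I"
  shows "(hnorm ip (\<Sum>i\<in>I. fscale (a i) (w i)))\<^sup>2 \<le> C * (\<Sum>i\<in>I. (cmod (a i))\<^sup>2)"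
proof -
  have v: "v n \<in> H" and w: "w n \<in> H" and vw: "ip (v n) (w m) = (if n = m then 1 else 0)" for n m
    using bio unfolding biorthogonal_def by auto
  have wv: "ip (w m) (v n) = (if n = m then 1 else 0)" for n m
    using ip_cnj[of "v n" "w m"] v w vw[of n m] by simp
  let ?g = "\<Sum>i\<in>I. fscale (a i) (w i)"
  define S where "S = (\<Sum>i\<in>I. (cmod (a i))\<^sup>2)"
  have S: "S \<ge> 0" unfolding S_def by (simp add: sum_nonneg)
  have g: "?g \<in> H" by (intro sum_mem scale_mem w)
  have dense: "cmod (ip ?g y) \<le> sqrt (C * S) * hnorm ip y" if y: "y \<in> cfun.span (range v)" for y
  proof -
    obtain J b where J: "finite J" and y_eq: "y = (\<Sum>j\<in>J. fscale (b j) (v j))"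
      using span_range_explicit[OF y] by blast
    \<comment> \<open>Extension by zero brings both coefficient families to the common index set
      \<open>I \<union> J\<close>.\<close>
    define b' where "b' = (\<lambda>j. if j \<in> J then b j else 0)"
    have y': "y = (\<Sum>j\<in>I \<union> J. fscale (b' j) (v j))"
      unfolding y_eq b'_def using I J by (intro sum.mono_neutral_cong_left) auto
    have yH: "y \<in> H" unfolding y_eq by (intro sum_mem scale_mem v)
    have "ip (w i) y = (\<Sum>j\<in>I \<union> J. cnj (b' j) * ip (w i) (v j))" for i
      unfolding y' by (rule ip_sum_right[OF v w])
    then have "ip ?g y = (\<Sum>i\<in>I. a i * (\<Sum>j\<in>I \<union> J. cnj (b' j) * ip (w i) (v j)))"
      unfolding ip_sum[OF w yH] by simp
    also have "\<dots> = (\<Sum>i\<in>I. a i * cnj (b' i))"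
      using I J by (intro sum.cong) (auto simp: wv if_distrib cong: if_cong)
    finally have "cmod (ip ?g y) \<le> (\<Sum>i\<in>I. cmod (a i) * cmod (b' i))"
      by (simp add: norm_mult order_trans[OF norm_sum])
    also have "\<dots> \<le> L2_set (\<lambda>i. cmod (a i)) I * L2_set (\<lambda>i. cmod (b' i)) I"
      using L2_set_mult_ineq[of "\<lambda>i. cmod (a i)" "\<lambda>i. cmod (b' i)" I] by simp
    also have "\<dots> = sqrt S * sqrt (\<Sum>i\<in>I. (cmod (b' i))\<^sup>2)"
      by (simp add: L2_set_def S_def)
    also have "\<dots> \<le> sqrt S * sqrt (C * (hnorm ip y)\<^sup>2)"
    proof (intro mult_left_mono real_sqrt_le_mono)
      have "(\<Sum>i\<in>I. (cmod (b' i))\<^sup>2) \<le> (\<Sum>i\<in>I \<union> J. (cmod (b' i))\<^sup>2)"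
        using I J by (intro sum_mono2) auto
      also have "\<dots> \<le> C * (hnorm ip y)\<^sup>2" unfolding y' using I J by (intro bound) auto
      finally show "(\<Sum>i\<in>I. (cmod (b' i))\<^sup>2) \<le> C * (hnorm ip y)\<^sup>2" .
    qed (use S in auto)
    also have "\<dots> = sqrt (C * S) * hnorm ip y"
      using hnorm_ge_0[OF yH] by (simp add: real_sqrt_mult)
    finally show ?thesis .
  qed
  \<comment> \<open>The estimate on the span is to be applied to \<open>?g\<close> itself:
    \<open>?g\<close> is replaced by a span element within \<open>r\<close>, and then
    \<open>r\<close> tends to 0.\<close>
  have "(hnorm ip ?g)\<^sup>2 \<le> sqrt (C * S) * (hnorm ip ?g + r) + hnorm ip ?g * r" if r: "r > 0" for r
  proof -
    have range_v: "range v \<subseteq> H" using v by auto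
    have "?g \<in> closed_span H ip (range v)" using complete g unfolding complete_system_def by simp
    then obtain y where y: "y \<in> cfun.span (range v)" "hnorm ip (?g - y) < r"
      unfolding closed_span_iff[OF range_v] using r by blast
    have yH: "y \<in> H" using y span_subset[OF range_v] by auto
    have "y - ?g + ?g = y" by simp
    then have "hnorm ip y \<le> hnorm ip (y - ?g) + hnorm ip ?g"
      using hnorm_triangle[OF diff_mem[OF yH g] g] by simp
    then have ny: "hnorm ip y \<le> hnorm ip ?g + r"
      using y(2) hnorm_minus_commute[OF yH g] by linarith
    have "(hnorm ip ?g)\<^sup>2 = cmod (ip ?g ?g)"
      unfolding ip_self[OF g] by (simp only: norm_of_real abs_power2)
    also have "ip ?g ?g = ip ?g y + ip ?g (?g - y)" using g yH by (simp add: ip_diff_right)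
    also have "cmod \<dots> \<le> cmod (ip ?g y) + cmod (ip ?g (?g - y))" by (rule norm_triangle_ineq)
    also have "\<dots> \<le> sqrt (C * S) * hnorm ip y + hnorm ip ?g * hnorm ip (?g - y)"
      using dense[OF y(1)] cmod_ip_le[OF g diff_mem[OF g yH]] by linarith
    also have "\<dots> \<le> sqrt (C * S) * (hnorm ip ?g + r) + hnorm ip ?g * r"
      using ny y S C hnorm_ge_0[OF g] by (intro add_mono mult_left_mono) auto
    finally show ?thesis .
  qed
  moreover have "((\<lambda>r. sqrt (C * S) * (hnorm ip ?g + r) + hnorm ip ?g * r) \<longlongrightarrow>
      sqrt (C * S) * (hnorm ip ?g + 0) + hnorm ip ?g * 0) (at_right 0)"
    by (intro tendsto_intros)
  ultimately have "(hnorm ip ?g)\<^sup>2 \<le> sqrt (C * S) * (hnorm ip ?g + 0) + hnorm ip ?g * 0"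
    by (intro tendsto_lowerbound[of "\<lambda>r. sqrt (C * S) * (hnorm ip ?g + r) + hnorm ip ?g * r"
          _ "at_right 0"]) (auto simp: eventually_at_right_field intro: exI[of _ 1])
  then have "hnorm ip ?g * hnorm ip ?g \<le> sqrt (C * S) * hnorm ip ?g"
    by (simp add: power2_eq_square)
  then have "hnorm ip ?g \<le> sqrt (C * S)"
    using hnorm_ge_0[OF g] S C by (cases "hnorm ip ?g = 0") (auto simp: mult_le_cancel_right)
  then have "(hnorm ip ?g)\<^sup>2 \<le> (sqrt (C * S))\<^sup>2" using hnorm_ge_0[OF g] by (intro power_mono)
  then show ?thesis using S C unfolding S_def by simp
qed

end

text \<open>The upper bound makes the partial sums Cauchy. The conclusion is stated weakly: kernels
  as \<open>x\<close> yield pointwise convergence, and biorthogonal vectors yield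
  coefficients.\<close>

lemma (in hilbert_function_space) l2_series:
  assumes u: "\<And>n. u n \<in> H"
    and bound: "\<And>I a. finite I \<Longrightarrow>
      (hnorm ip (\<Sum>i\<in>I. fscale (a i) (u i)))\<^sup>2 \<le> C * (\<Sum>i\<in>I. (cmod (a i))\<^sup>2)"
    and C: "C > 0" and a: "summable (\<lambda>n. (cmod (a n))\<^sup>2)"
  obtains g where "g \<in> H" "\<And>x. x \<in> H \<Longrightarrow> (\<lambda>n. a n * ip (u n) x) sums ip g x"
proof -
  define s where "s = (\<lambda>N. \<Sum>i<N. fscale (a i) (u i))"
  have s: "s N \<in> H" for N unfolding s_def by (intro sum_mem scale_mem u)
  have diff: "s n - s m = (\<Sum>i\<in>{m..<n}. fscale (a i) (u i))" if "m \<le> n" for m n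
    using sum_diff_nat_ivl[of 0 m n "\<lambda>i. fscale (a i) (u i)"] that
    by (simp add: s_def lessThan_atLeast0)
  have "\<exists>N. \<forall>n\<ge>N. \<forall>m\<ge>N. hnorm ip (s n - s m) < e" if e: "e > 0" for e
  proof -
    have "0 < e\<^sup>2 / C" using e C by simp
    then obtain N where N: "\<And>m n. m \<ge> N \<Longrightarrow> norm (\<Sum>i\<in>{m..<n}. (cmod (a i))\<^sup>2) < e\<^sup>2 / C"
      using a unfolding summable_Cauchy by meson
    have less: "hnorm ip (s n - s m) < e" if "N \<le> m" "m \<le> n" for m n
    proof (rule power_less_imp_less_base[where n = 2])
      have "(hnorm ip (s n - s m))\<^sup>2 \<le> C * (\<Sum>i\<in>{m..<n}. (cmod (a i))\<^sup>2)"
        unfolding diff[OF \<open>m \<le> n\<close>] by (rule bound) simp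
      also have "\<dots> < C * (e\<^sup>2 / C)"
        using N[OF \<open>N \<le> m\<close>, of n] C by (intro mult_strict_left_mono) (auto simp: sum_nonneg)
      finally show "(hnorm ip (s n - s m))\<^sup>2 < e\<^sup>2" using C by simp
    qed (use e in auto)
    have "hnorm ip (s n - s m) < e" if "N \<le> m" "N \<le> n" for m n
      using less[of m n] less[of n m] that hnorm_minus_commute[OF s s] by (metis nle_le)
    then show ?thesis by blast
  qed
  then obtain g where g: "g \<in> H" "(\<lambda>n. hnorm ip (s n - g)) \<longlonglongrightarrow> 0"
    using hnorm_Cauchy_convergent[of s] s by blast
  have "(\<lambda>n. a n * ip (u n) x) sums ip g x" if x: "x \<in> H" for x
    using ip_tendsto_left[OF g(1) s g(2) x] ip_sum[OF u x, where a = a]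
    unfolding sums_def s_def by simp
  then show thesis using that g by blast
qed

lemma summable_mult_l2:
  fixes a b :: "nat \<Rightarrow> 'a::real_normed_div_algebra"
  assumes "summable (\<lambda>n. (norm (a n))\<^sup>2)" "summable (\<lambda>n. (norm (b n))\<^sup>2)"
  shows "summable (\<lambda>n. norm (a n * b n))"
proof (rule summable_comparison_test'[OF summable_add[OF assms], of 0])
  fix n
  have "0 \<le> (norm (a n) - norm (b n))\<^sup>2 + ((norm (a n))\<^sup>2 + (norm (b n))\<^sup>2)" by simp
  then show "norm (norm (a n * b n)) \<le> (norm (a n))\<^sup>2 + (norm (b n))\<^sup>2"
    by (simp add: norm_mult power2_diff)
qed

section \<open>Entire functions\<close>

lemma holomorphic_divide_zero:
  assumes "f holomorphic_on UNIV" "f a = 0"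
  shows "divide_zero f a holomorphic_on UNIV"
  using pole_lemma[OF assms(1), of a] assms(2) by (simp add: divide_zero_def cong: if_cong)

lemma divide_zero_mult:
  assumes "f w = 0"
  shows "divide_zero f w z * (z - w) = f z"
  using assms by (simp add: divide_zero_def)

lemma entire_countable_zeros:
  assumes "f holomorphic_on UNIV" "\<not> f constant_on UNIV"
  shows "countable {z. f z = 0}"
  using holomorphic_countable_zeros[OF assms(1) open_UNIV connected_UNIV fsigma_UNIV assms(2)]
  by simp

text \<open>At a zero of \<open>g\<close> both functions are divided by the same linear factor. As
  that zero is simple, the new denominator does not vanish there, and the value to fill in is the
  quotient of derivatives.\<close>

lemma entire_quotient:
  assumes f: "f holomorphic_on UNIV" and g: "g holomorphic_on UNIV"
    and zeros: "\<And>z. g z = 0 \<Longrightarrow> deriv g z \<noteq> 0 \<and> f z = 0"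
  obtains E where "E holomorphic_on UNIV" "\<And>z. f z = E z * g z"
proof
  define E where "E = (\<lambda>z. if g z = 0 then deriv f z / deriv g z else f z / g z)"
  show "f z = E z * g z" for z using zeros[of z] by (simp add: E_def)
  have "E analytic_on {a}" for a
  proof (cases "g a = 0")
    case True
    define f1 g1 where "f1 = divide_zero f a" and "g1 = divide_zero g a"
    have f1: "f1 holomorphic_on UNIV" and g1: "g1 holomorphic_on UNIV"
      using True zeros f g by (simp_all add: f1_def g1_def holomorphic_divide_zero)
    have "g1 a \<noteq> 0" using True zeros by (simp add: g1_def divide_zero_def)
    then have "(\<lambda>z. f1 z / g1 z) analytic_on {a}"
      using f1 g1 by (intro analytic_intros) (auto simp: analytic_on_open analytic_at intro!: exI[of _ UNIV])
    moreover have "\<forall>\<^sub>F z in nhds a. E z = f1 z / g1 z"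
    proof -
      have "isCont g1 a" using g1 by (metis UNIV_I continuous_on_eq_continuous_at holomorphic_on_imp_continuous_on open_UNIV)
      then have "\<forall>\<^sub>F z in nhds a. g1 z \<noteq> 0"
        using \<open>g1 a \<noteq> 0\<close> tendsto_imp_eventually_ne[of g1 "g1 a" "nhds a" 0]
        by (simp add: isCont_def tendsto_at_iff_tendsto_nhds)
      then show ?thesis
      proof eventually_elim
        case (elim z)
        show ?case
        proof (cases "z = a")
          case False
          have "g z \<noteq> 0" using elim False by (auto simp: g1_def divide_zero_def)
          then show ?thesis using False by (simp add: E_def f1_def g1_def divide_zero_def)
        qed (use True in \<open>simp add: E_def f1_def g1_def divide_zero_def\<close>)
      qed
    qed
    ultimately show ?thesis by (simp add: analytic_at_cong)
  next
    case False
    then have "(\<lambda>z. f z / g z) analytic_on {a}"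
      using f g by (intro analytic_intros) (auto simp: analytic_on_open analytic_at intro!: exI[of _ UNIV])
    moreover have "isCont g a" using g by (metis UNIV_I continuous_on_eq_continuous_at holomorphic_on_imp_continuous_on open_UNIV)
    then have "\<forall>\<^sub>F z in nhds a. g z \<noteq> 0"
      using False tendsto_imp_eventually_ne[of g "g a" "nhds a" 0]
      by (simp add: isCont_def tendsto_at_iff_tendsto_nhds)
    then have "\<forall>\<^sub>F z in nhds a. E z = f z / g z"
      by eventually_elim (simp add: E_def)
    ultimately show ?thesis by (simp add: analytic_at_cong)
  qed
  then show "E holomorphic_on UNIV"
    by (metis UNIV_I analytic_imp_holomorphic analytic_on_analytic_at)
qed

text \<open>A multiple zero of \<open>f + s g\<close> is a zero of the Wronskian, and it determines \<open>s\<close>.\<close>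

lemma simple_zeros_pencil:
  assumes f: "f holomorphic_on UNIV" and g: "g holomorphic_on UNIV"
    and g_simple: "\<And>z. g z = 0 \<Longrightarrow> deriv g z \<noteq> 0"
    and wronskian: "deriv f a * g a \<noteq> f a * deriv g a"
  obtains s :: real where "s > B"
    "\<And>z. f z + of_real s * g z = 0 \<Longrightarrow> deriv f z + of_real s * deriv g z \<noteq> 0"
proof -
  define W where "W = (\<lambda>z. deriv f z * g z - f z * deriv g z)"
  have W: "W holomorphic_on UNIV"
    unfolding W_def using f g by (intro holomorphic_intros) auto
  have countable_W: "countable {z. W z = 0}"
  proof (cases "W constant_on UNIV")
    case True
    then obtain c where c: "\<And>z. W z = c" by (auto simp: constant_on_def)
    have "W a \<noteq> 0" using wronskian by (simp add: W_def)
    then have "{z. W z = 0} = {}" unfolding c by simp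
    then show ?thesis by simp
  next
    case False
    then show ?thesis by (rule entire_countable_zeros[OF W])
  qed
  \<comment> \<open>The only parameter for which \<open>z\<close> can be a multiple zero; where
    \<open>g\<close> vanishes it is read off from the derivatives. An interval is uncountable, so it
    contains a value avoiding all of these.\<close>
  define \<sigma> where "\<sigma> = (\<lambda>z. if g z = 0 then Re (- deriv f z / deriv g z) else Re (- f z / g z))"
  have "countable (\<sigma> ` {z. W z = 0})" using countable_W by simp
  moreover have "uncountable {B<..<B+1}" by (simp add: uncountable_open_interval)
  ultimately obtain s where s: "s \<in> {B<..<B+1}" "s \<notin> \<sigma> ` {z. W z = 0}"
    by (metis countable_subset subsetI)
  show thesis
  proof (rule that)
    fix z assume z: "f z + of_real s * g z = 0"
    show "deriv f z + of_real s * deriv g z \<noteq> 0"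
    proof
      assume d: "deriv f z + of_real s * deriv g z = 0"
      have fz: "f z = - of_real s * g z" and dz: "deriv f z = - of_real s * deriv g z"
        using z d by (simp_all add: add_eq_0_iff2)
      have "W z = 0" by (simp add: W_def fz dz)
      moreover have "\<sigma> z = s"
        using g_simple[of z] by (simp add: \<sigma>_def fz dz)
      ultimately show False using s(2) by blast
    qed
  qed (use s in auto)
qed

text \<open>The maximum principle carries the bound from arbitrarily large circles to the whole
  plane, where Liouville's theorem applies.\<close>

lemma bounded_on_circles_constant:
  assumes E: "E holomorphic_on UNIV"
    and circles: "\<And>B. \<exists>R>B. \<forall>z. cmod z = R \<longrightarrow> cmod (E z) \<le> C"
  shows "E constant_on UNIV"
proof (rule Liouville_theorem[OF E])
  have "cmod (E x) \<le> C" for x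
  proof -
    obtain R where R: "R > cmod x" "\<And>z. cmod z = R \<Longrightarrow> cmod (E z) \<le> C" using circles by metis
    then have "R > 0" using norm_ge_zero[of x] by linarith
    show ?thesis
    proof (rule maximum_modulus_frontier[of E "cball 0 R"])
      show "E holomorphic_on interior (cball 0 R)" using E holomorphic_on_subset by blast
      show "continuous_on (closure (cball 0 R)) E"
        using E holomorphic_on_imp_continuous_on continuous_on_subset by blast
    qed (use R \<open>R > 0\<close> in auto)
  qed
  then show "bounded (range E)" by (auto simp: bounded_iff)
qed

text \<open>The indices are picked one after another, each so far out that all smallness conditions
  hold at a geometric rate and a wide annulus separates its point from the preceding ones.\<close>

lemma lacunary_support:
  fixes t :: "nat \<Rightarrow> complex" and b :: "nat \<Rightarrow> real"
  assumes t: "filterlim (\<lambda>n. cmod (t n)) at_top sequentially"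
    and b: "b \<longlonglongrightarrow> 0"
  obtains N where "infinite N" "infinite (- N)" "N \<inter> {..<m} = {}"
    "summable (\<lambda>n. if n \<in> N then \<bar>b n\<bar> else 0)"
    "summable (\<lambda>n. if n \<in> N then 1 / (cmod (t n - p))\<^sup>2 else 0)"
    "\<And>n. n \<in> N \<Longrightarrow> t n \<noteq> p"
    "\<And>B :: real. \<exists>R>B. \<forall>z. cmod z = R \<longrightarrow> z \<notin> range t \<and> (\<forall>n\<in>N. cmod z \<le> 2 * cmod (z - t n))"
proof -
  \<comment> \<open>The first two conditions give the two summable series, the third keeps indices
    below \<open>m\<close> out, and the last makes the radii exceed every bound.\<close>
  define P where "P = (\<lambda>k n. 2 ^ k \<le> cmod (t n - p) \<and> \<bar>b n\<bar> \<le> (1/2) ^ k \<and> m \<le> n \<and> 8 ^ k \<le> cmod (t n))"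
  \<comment> \<open>The gap of 2 leaves each successor \<open>Suc (r k)\<close> outside the range,
    so the complement is infinite; the factor 8 makes room for a circle of radius between
    \<open>2 * T\<close> and \<open>3 * T\<close>.\<close>
  define Q where "Q = (\<lambda>(k::nat) n n'. n + 2 \<le> n' \<and> 8 * cmod (t n) \<le> cmod (t n'))"
  have large: "\<forall>\<^sub>F n in sequentially. c \<le> cmod (t n)" for c
    using t by (simp add: filterlim_at_top)
  have P: "\<forall>\<^sub>F n in sequentially. P k n" for k
  proof -
    have "\<forall>\<^sub>F n in sequentially. \<bar>b n\<bar> < (1/2) ^ k"
      using order_tendstoD(2)[OF tendsto_rabs_zero[OF b]] by simp
    moreover have "\<forall>\<^sub>F n in sequentially. m \<le> n" by (rule eventually_ge_at_top)
    ultimately show ?thesis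
      using large[of "2 ^ k + cmod p"] large[of "8 ^ k"]
    proof eventually_elim
      case (elim n)
      then show ?case using norm_triangle_ineq2[of "t n" p] by (simp add: P_def)
    qed
  qed
  have "\<exists>r. \<forall>k. P k (r k) \<and> Q k (r k) (r (Suc k))"
  proof (rule dependent_nat_choice)
    show "\<exists>n. P 0 n" using eventually_happens'[OF sequentially_bot P] .
    fix n k
    have "\<forall>\<^sub>F n' in sequentially. P (Suc k) n' \<and> Q k n n'"
      unfolding Q_def by (intro eventually_conj P large eventually_ge_at_top)
    then show "\<exists>n'. P (Suc k) n' \<and> Q k n n'" using eventually_happens'[OF sequentially_bot] by blast
  qed
  then obtain r where r: "\<And>k. P k (r k)" and Q: "\<And>k. Q k (r k) (r (Suc k))" by blast
  have mono: "strict_mono r"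
    unfolding strict_mono_Suc_iff
  proof
    show "r k < r (Suc k)" for k using Q[of k] by (simp add: Q_def)
  qed
  have incr: "cmod (t (r j)) \<le> cmod (t (r k))" if "j \<le> k" for j k
    using that
  proof (rule lift_Suc_mono_le[rotated])
    show "cmod (t (r k)) \<le> cmod (t (r (Suc k)))" for k
      using Q[of k] norm_ge_zero[of "t (r k)"] unfolding Q_def by linarith
  qed
  have geometric: "summable (\<lambda>k. (1/2::real) ^ k)" by (rule summable_geometric) simp
  show thesis
  proof (rule that[of "range r"])
    show "infinite (range r)" using mono by (simp add: strict_mono_imp_inj_on range_inj_infinite)
    have "Suc (r k) \<noteq> r j" for j k
    proof
      assume *: "Suc (r k) = r j"
      then have "k < j" using mono by (metis lessI strict_mono_less)
      then have "r (Suc k) \<le> r j" using mono by (simp add: strict_mono_less_eq)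
      then show False using Q[of k] * by (simp add: Q_def)
    qed
    then have "range (\<lambda>k. Suc (r k)) \<subseteq> - range r" by auto
    moreover have "inj (\<lambda>k. Suc (r k))" using mono by (simp add: inj_def strict_mono_eq)
    ultimately show "infinite (- range r)" using finite_subset range_inj_infinite by blast
    have "m \<le> r k" for k using r[of k] by (simp add: P_def)
    then show "range r \<inter> {..<m} = {}" by (auto simp: not_less[symmetric])
    have "0 < cmod (t (r k) - p)" for k
      using r[of k] zero_less_power[of "2::real" k] unfolding P_def by linarith
    then show "t n \<noteq> p" if "n \<in> range r" for n using that by auto
    have "summable (\<lambda>k. if r k \<in> range r then \<bar>b (r k)\<bar> else 0)"
      using r by (intro summable_comparison_test'[OF geometric, of 0]) (simp add: P_def)
    then show "summable (\<lambda>n. if n \<in> range r then \<bar>b n\<bar> else 0)"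
      using summable_mono_reindex[OF mono, of "\<lambda>n. if n \<in> range r then \<bar>b n\<bar> else 0"] by simp
    have "summable (\<lambda>k. if r k \<in> range r then 1 / (cmod (t (r k) - p))\<^sup>2 else 0)"
    proof (intro summable_comparison_test'[OF geometric, of 0])
      fix k
      have "(2::real) ^ k \<le> (2 ^ k)\<^sup>2" by (simp add: power2_eq_square)
      also have "\<dots> \<le> (cmod (t (r k) - p))\<^sup>2" using r[of k] by (intro power_mono) (auto simp: P_def)
      finally have "1 / (cmod (t (r k) - p))\<^sup>2 \<le> 1 / 2 ^ k" by (intro frac_le) auto
      then show "norm (if r k \<in> range r then 1 / (cmod (t (r k) - p))\<^sup>2 else 0) \<le> (1/2) ^ k"
        by (simp add: power_one_over)
    qed
    then show "summable (\<lambda>n. if n \<in> range r then 1 / (cmod (t n - p))\<^sup>2 else 0)"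
      using summable_mono_reindex[OF mono, of "\<lambda>n. if n \<in> range r then 1 / (cmod (t n - p))\<^sup>2 else 0"]
      by simp
    fix B :: real
    obtain j where j: "B < 8 ^ j" using real_arch_pow[of 8 B] by auto
    define T where "T = cmod (t (r j))"
    have T: "B < T" "T > 0"
      using j r[of j] zero_less_power[of "8::real" j] unfolding P_def T_def by linarith+
    have "countable (range (\<lambda>n. cmod (t n)))" by simp
    moreover have "uncountable {2 * T<..<3 * T}" using T by (simp add: uncountable_open_interval)
    \<comment> \<open>Selected points up to step \<open>j\<close> have modulus at most
      \<open>T < R / 2\<close>, later ones at least \<open>8 * T\<close>, so both lie at distance at
      least \<open>R / 2\<close> from the circle. Only countably many radii meet
      \<open>range t\<close>.\<close>
    ultimately obtain R where R: "R \<in> {2 * T<..<3 * T}" "R \<notin> range (\<lambda>n. cmod (t n))"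
      by (metis countable_subset subsetI)
    show "\<exists>R>B. \<forall>z. cmod z = R \<longrightarrow> z \<notin> range t \<and> (\<forall>n\<in>range r. cmod z \<le> 2 * cmod (z - t n))"
    proof (intro exI[of _ R] conjI allI impI ballI)
      show "B < R" using R T by auto
      fix z assume z: "cmod z = R"
      show "z \<notin> range t" using R z by auto
      fix n assume "n \<in> range r"
      then obtain k where n: "n = r k" by blast
      show "cmod z \<le> 2 * cmod (z - t n)"
      proof (cases "k \<le> j")
        case True
        then have "cmod (t n) \<le> T" using incr n by (simp add: T_def)
        then show ?thesis using R z norm_triangle_ineq2[of z "t n"] by auto
      next
        case False
        then have "cmod (t (r (Suc j))) \<le> cmod (t n)" using incr[of "Suc j" k] n by simp
        then have "8 * T \<le> cmod (t n)" using Q[of j] unfolding Q_def T_def by linarith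
        then show ?thesis using R z T norm_triangle_ineq2[of "t n" z] by (auto simp: norm_minus_commute)
      qed
    qed
  qed
qed

section \<open>Division by linear factors and Cauchy sums\<close>

lemma divide_zero_eqI:
  assumes g: "g holomorphic_on UNIV" and G: "\<And>z. G z = (z - a) * g z"
  shows "divide_zero G a = g"
proof
  fix z
  have "G = (\<lambda>z. (z - a) * g z)" using G by blast
  moreover have "((\<lambda>z. (z - a) * g z) has_field_derivative 1 * g a + deriv g a * (a - a)) (at a)"
    using g by (intro DERIV_mult holomorphic_derivI[of g UNIV]) (auto intro!: derivative_eq_intros)
  ultimately have "deriv G a = g a" by (simp add: DERIV_imp_deriv)
  then show "divide_zero G a z = g z" by (simp add: divide_zero_def G)
qed

text \<open>This is \<open>1/(z-b) = 1/(z-a) + (b-a)/((z-a)(z-b))\<close> multiplied by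
  \<open>G\<close>. It transfers information from one zero of \<open>G\<close> to another.\<close>

lemma divide_zero_shift:
  assumes G: "G holomorphic_on UNIV" and "G a = 0" "G b = 0" "a \<noteq> b"
  shows "divide_zero G b = divide_zero G a + fscale (b - a) (divide_zero (divide_zero G a) b)"
proof -
  define q where "q = divide_zero G a"
  have q: "q holomorphic_on UNIV" and qb: "q b = 0"
    using assms by (simp_all add: q_def holomorphic_divide_zero) (simp add: divide_zero_def)
  have Gq: "G z = (z - a) * q z" for z
    using divide_zero_mult[of G a z] assms(2) by (simp add: q_def mult.commute)
  have "divide_zero G b = q + fscale (b - a) (divide_zero q b)"
  proof (rule divide_zero_eqI)
    show "q + fscale (b - a) (divide_zero q b) holomorphic_on UNIV"
      unfolding plus_fun_def fscale_def
      by (intro holomorphic_intros q holomorphic_divide_zero qb)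
    show "G z = (z - b) * (q + fscale (b - a) (divide_zero q b)) z" for z
    proof -
      have "(z - b) * (q + fscale (b - a) (divide_zero q b)) z
          = (z - b) * q z + (b - a) * (divide_zero q b z * (z - b))"
        by (simp add: fscale_def algebra_simps)
      also have "\<dots> = (z - a) * q z" unfolding divide_zero_mult[of q, OF qb] by (simp add: algebra_simps)
      finally show ?thesis by (simp add: Gq)
    qed
  qed
  then show ?thesis by (simp add: q_def)
qed

text \<open>After multiplication by \<open>z\<close>, each term is at most twice its coefficient.
  The distance condition concerns only the support of \<open>a\<close>, which is what permits sparse
  supports.\<close>

lemma cauchy_sum_bound:
  fixes z :: complex
  assumes a: "summable (\<lambda>n. cmod (a n))" and y: "(\<lambda>n. a n / (z - t n)) sums y"
    and dist: "\<And>n. a n \<noteq> 0 \<Longrightarrow> z \<noteq> t n \<and> cmod z \<le> 2 * cmod (z - t n)"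
  shows "cmod z * cmod y \<le> 2 * (\<Sum>n. cmod (a n))"
proof -
  have le: "cmod (z * (a n / (z - t n))) \<le> 2 * cmod (a n)" for n
  proof (cases "a n = 0")
    case False
    then have "0 < cmod (z - t n)" "cmod z * cmod (a n) \<le> 2 * cmod (z - t n) * cmod (a n)"
      using dist[of n] by (auto intro: mult_right_mono)
    then show ?thesis by (simp add: norm_mult norm_divide field_simps)
  qed simp
  have sums: "(\<lambda>n. z * (a n / (z - t n))) sums (z * y)" using y by (rule sums_mult)
  have summ: "summable (\<lambda>n. 2 * cmod (a n))" using a by (rule summable_mult)
  have "cmod (z * y) = cmod (\<Sum>n. z * (a n / (z - t n)))" using sums by (simp add: sums_iff)
  also have "\<dots> \<le> (\<Sum>n. 2 * cmod (a n))" using le summ by (rule norm_suminf_le)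
  finally show ?thesis using suminf_mult[OF a, of 2] by (simp add: norm_mult)
qed

section \<open>Spaces of the class R\<close>

context class_R
begin

lemma is_rep_kernel: "is_rep_kernel H ip x (rep_kernel H ip x)"
  using A1[of x] rep_kernel_eq by metis

lemma rep_kernel_mem: "rep_kernel H ip x \<in> H"
  and ip_rep_kernel: "f \<in> H \<Longrightarrow> ip f (rep_kernel H ip x) = f x"
  using is_rep_kernel[of x] by (simp_all add: is_rep_kernel_def)

lemma rep_kernel_ip: "f \<in> H \<Longrightarrow> ip (rep_kernel H ip x) f = cnj (f x)"
  using ip_cnj[of f "rep_kernel H ip x"] by (simp add: rep_kernel_mem ip_rep_kernel)

text \<open>In the shift identity the correction term is a quotient of a member of \<open>H\<close>
  by a linear factor, so \<open>A2\<close> applies to it.\<close>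

lemma divide_zero_mem:
  assumes "G holomorphic_on UNIV" "G a = 0" "divide_zero G a \<in> H" "G b = 0"
  shows "divide_zero G b \<in> H"
proof (cases "a = b")
  case False
  then have "divide_zero G a b = 0" using assms by (simp add: divide_zero_def)
  then show ?thesis
    unfolding divide_zero_shift[OF assms(1,2,4) False]
    using assms(3) A2[of "divide_zero G a" b] by (simp add: add_mem scale_mem)
qed (use assms in auto)

end

section \<open>The generating function and its biorthogonal system\<close>

locale weighted_class_R = class_R +
  fixes t :: "nat \<Rightarrow> complex" and F :: cfun
  assumes points: "riesz_kernel_points H ip t"
    and generating: "generating_function H ip t F"
    and weights: "summable (weight H ip t F)"
begin

definition kn :: "nat \<Rightarrow> real" where "kn n = hnorm ip (rep_kernel H ip (t n))"

definition v :: "nat \<Rightarrow> cfun" where "v n = normalized_kernel H ip (t n)"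

definition w :: "nat \<Rightarrow> cfun" where
  "w n = fscale (complex_of_real (kn n) / deriv F (t n)) (divide_zero F (t n))"

lemma inj_t: "inj t"
  using points by (simp add: riesz_kernel_points_def)

lemma F_holomorphic: "F holomorphic_on UNIV"
  using generating by (simp add: generating_function_def)

lemma biorthogonal_vw: "biorthogonal H ip v w"
  using generating unfolding generating_function_def v_def[abs_def] w_def[abs_def] kn_def by simp

lemma v_mem: "v n \<in> H" and w_mem: "w n \<in> H"
  and v_w: "ip (v n) (w m) = (if n = m then 1 else 0)"
  using biorthogonal_vw by (auto simp: biorthogonal_def)

lemma w_v: "ip (w m) (v n) = (if n = m then 1 else 0)"
  using ip_cnj[of "v n" "w m"] by (simp add: v_w v_mem w_mem)

lemma w_nonzero: "w n \<noteq> 0"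
  using v_w[of n n] ip_zero_right[OF v_mem, of n] by auto

text \<open>Division by 0 yields 0, so a vanishing norm or derivative would make \<open>w n\<close>
  zero, against biorthogonality.\<close>

lemma kn_pos: "0 < kn n" and deriv_F_nonzero: "deriv F (t n) \<noteq> 0"
proof -
  have "complex_of_real (kn n) / deriv F (t n) \<noteq> 0"
    using w_nonzero[of n] by (auto simp: w_def fscale_def fun_eq_iff)
  then show "0 < kn n" "deriv F (t n) \<noteq> 0"
    using hnorm_ge_0[OF rep_kernel_mem, of "t n"] by (auto simp: kn_def)
qed

lemma kn_nonzero: "kn n \<noteq> 0"
  using kn_pos[of n] by simp

lemma divide_F_mem: "divide_zero F (t n) \<in> H"
proof -
  have "divide_zero F (t n) = fscale (deriv F (t n) / complex_of_real (kn n)) (w n)"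
    using kn_pos[of n] deriv_F_nonzero[of n] by (auto simp: w_def fscale_def fun_eq_iff)
  then show ?thesis using scale_mem[OF w_mem] by simp
qed

text \<open>Off \<open>t n\<close>, \<open>F\<close> is \<open>z - t n\<close> times the quotient,
  which belongs to \<open>H\<close> and is therefore continuous at \<open>t n\<close>; hence
  \<open>F\<close> tends to 0 there.\<close>

lemma F_zero: "F (t n) = 0"
proof (rule tendsto_unique)
  let ?d = "divide_zero F (t n)"
  have cont: "isCont f (t n)" if "f holomorphic_on UNIV" for f
    using that by (metis UNIV_I continuous_on_eq_continuous_at holomorphic_on_imp_continuous_on open_UNIV)
  show "(F \<longlongrightarrow> F (t n)) (at (t n))" using cont[OF F_holomorphic] by (simp add: isCont_def)
  have "((\<lambda>z. ?d z * (z - t n)) \<longlongrightarrow> ?d (t n) * (t n - t n)) (at (t n))"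
    using cont[OF entire[OF divide_F_mem]] by (intro tendsto_intros) (simp add: isCont_def)
  moreover have "\<forall>\<^sub>F z in at (t n). ?d z * (z - t n) = F z"
    by (simp add: eventually_at_filter divide_zero_def)
  ultimately show "(F \<longlongrightarrow> 0) (at (t n))" by (simp add: tendsto_cong)
qed simp

lemma ip_v: "f \<in> H \<Longrightarrow> ip f (v n) = f (t n) / complex_of_real (kn n)"
  by (simp add: v_def normalized_kernel_def ip_scale_right rep_kernel_mem ip_rep_kernel kn_def)

text \<open>Duality supplies the second upper bound, so square-summable coefficients can be
  synthesized along \<open>w\<close> as well as along \<open>v\<close>.\<close>

lemma riesz_bounds:
  obtains C where "C > 0" "complete_system H ip (range v)"
    "\<And>I a. finite I \<Longrightarrow>
      (hnorm ip (\<Sum>i\<in>I. fscale (a i) (v i)))\<^sup>2 \<le> C * (\<Sum>i\<in>I. (cmod (a i))\<^sup>2)"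
    "\<And>I a. finite I \<Longrightarrow>
      (hnorm ip (\<Sum>i\<in>I. fscale (a i) (w i)))\<^sup>2 \<le> C * (\<Sum>i\<in>I. (cmod (a i))\<^sup>2)"
proof -
  have "riesz_basis H ip v"
    using points by (simp add: riesz_kernel_points_def v_def[abs_def])
  then obtain C where C: "C > 0" "complete_system H ip (range v)"
    "\<And>I a. finite I \<Longrightarrow>
      (hnorm ip (\<Sum>i\<in>I. fscale (a i) (v i)))\<^sup>2 \<le> C * (\<Sum>i\<in>I. (cmod (a i))\<^sup>2)"
    "\<And>I a. finite I \<Longrightarrow>
      (\<Sum>i\<in>I. (cmod (a i))\<^sup>2) \<le> C * (hnorm ip (\<Sum>i\<in>I. fscale (a i) (v i)))\<^sup>2"
    by (rule riesz_basis_bounds) blast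
  show thesis
    using C(1-3) biorthogonal_upper_bound[OF C(2) biorthogonal_vw _ C(4)]
    by (intro that[of C]) auto
qed

lemma complete_v: "complete_system H ip (range v)"
  by (rule riesz_bounds)

text \<open>Up to nonzero factors the values on \<open>T\<close> are the inner products with the
  complete system \<open>v\<close>.\<close>

lemma vanishing_on_t:
  assumes f: "f \<in> H" "\<And>n. f (t n) = 0"
  shows "f = 0"
proof -
  have "ip (v n) f = 0" for n using ip_cnj[OF f(1) v_mem, of n] f by (simp add: ip_v)
  then show "f = 0" using complete_system_orthogonal[OF complete_v f(1)] by blast
qed

section \<open>Interpolation, residues and expansions over \<open>T\<close>\<close>

lemma l2_values:
  assumes f: "f \<in> H"
  shows "summable (\<lambda>n. (cmod (f (t n) / complex_of_real (kn n)))\<^sup>2)"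
proof -
  obtain C where C: "C > 0" and bound: "\<And>I a. finite I \<Longrightarrow>
      (hnorm ip (\<Sum>i\<in>I. fscale (a i) (v i)))\<^sup>2 \<le> C * (\<Sum>i\<in>I. (cmod (a i))\<^sup>2)"
    by (rule riesz_bounds) blast
  show ?thesis
    using bessel_summable[OF v_mem less_imp_le[OF C] bound f] unfolding ip_v[OF f] .
qed

text \<open>These squared moduli are the weights. Paired with \<open>l2_values\<close> they make the
  residues absolutely summable.\<close>

lemma l2_weights: "summable (\<lambda>n. (cmod (complex_of_real (kn n) / deriv F (t n)))\<^sup>2)"
  using weights by (simp add: weight_def[abs_def] kn_def norm_divide power_divide)

lemma summable_residues: "f \<in> H \<Longrightarrow> summable (\<lambda>n. cmod (f (t n) / deriv F (t n)))"
  using summable_mult_l2[OF l2_values l2_weights, of f] by (simp add: kn_nonzero)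

text \<open>The function is synthesized along \<open>w\<close>; pairing with \<open>v n\<close>
  isolates one coefficient, and pairing with kernels gives the pointwise series.\<close>

lemma l2_interpolation:
  assumes a: "summable (\<lambda>n. (cmod (a n))\<^sup>2)"
  obtains g where "g \<in> H" "\<And>n. g (t n) = a n * complex_of_real (kn n)"
    "\<And>x. (\<lambda>n. a n * w n x) sums g x"
proof -
  obtain C where C: "C > 0" and bound: "\<And>I a. finite I \<Longrightarrow>
      (hnorm ip (\<Sum>i\<in>I. fscale (a i) (w i)))\<^sup>2 \<le> C * (\<Sum>i\<in>I. (cmod (a i))\<^sup>2)"
    by (rule riesz_bounds) blast
  obtain g where g: "g \<in> H" and sums: "\<And>x. x \<in> H \<Longrightarrow> (\<lambda>n. a n * ip (w n) x) sums ip g x"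
    using l2_series[OF w_mem bound C a] by blast
  have "g (t n) = a n * complex_of_real (kn n)" for n
  proof -
    have "(\<lambda>m. a m * ip (w m) (v n)) = (\<lambda>m. if m = n then a m else 0)"
      by (auto simp: w_v)
    then have "(\<lambda>m. if m = n then a m else 0) sums ip g (v n)" using sums[OF v_mem, of n] by simp
    then have "ip g (v n) = a n" using sums_unique2[OF _ sums_single[of n a]] by blast
    then show ?thesis using kn_pos[of n] g by (simp add: ip_v field_simps)
  qed
  moreover have "(\<lambda>n. a n * w n x) sums g x" for x
    using sums[OF rep_kernel_mem, of x] g by (simp add: ip_rep_kernel w_mem)
  ultimately show thesis using that g by blast
qed

text \<open>A Lagrange interpolation formula: the function synthesized from the values of
  \<open>f\<close> agrees with \<open>f\<close> on \<open>T\<close>, a set of uniqueness.\<close>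

lemma expansion:
  assumes f: "f \<in> H" and x: "x \<notin> range t"
  shows "(\<lambda>n. f (t n) / deriv F (t n) * (F x / (x - t n))) sums f x"
proof -
  obtain g where g: "g \<in> H"
    and vals: "\<And>n. g (t n) = f (t n) / complex_of_real (kn n) * complex_of_real (kn n)"
    and sums: "\<And>x. (\<lambda>n. f (t n) / complex_of_real (kn n) * w n x) sums g x"
    using l2_interpolation[OF l2_values[OF f]] by blast
  have "f (t n) = g (t n)" for n using vals[of n] kn_pos[of n] by simp
  then have "f - g = 0" using f g by (intro vanishing_on_t diff_mem) auto
  then have "g = f" by simp
  moreover have "f (t n) / complex_of_real (kn n) * w n x
      = f (t n) / deriv F (t n) * (F x / (x - t n))" for n
    using x kn_pos[of n] by (auto simp: w_def fscale_def divide_zero_def)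
  ultimately show ?thesis using sums[of x] by simp
qed

text \<open>The representing vector is synthesized along \<open>v\<close> from the conjugates of the
  square-summable sequence in \<open>l2_weights\<close>; they are conjugated because
  \<open>ip\<close> is antilinear in its second argument.\<close>

lemma residue_functional:
  obtains h where "h \<in> H" "\<And>f. f \<in> H \<Longrightarrow> (\<lambda>n. f (t n) / deriv F (t n)) sums ip f h"
proof -
  define b where "b = (\<lambda>n. cnj (complex_of_real (kn n) / deriv F (t n)))"
  have b: "summable (\<lambda>n. (cmod (b n))\<^sup>2)"
    using l2_weights by (simp add: b_def norm_divide)
  obtain C where C: "C > 0" and bound: "\<And>I a. finite I \<Longrightarrow>
      (hnorm ip (\<Sum>i\<in>I. fscale (a i) (v i)))\<^sup>2 \<le> C * (\<Sum>i\<in>I. (cmod (a i))\<^sup>2)"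
    by (rule riesz_bounds) blast
  obtain h where h: "h \<in> H" and sums: "\<And>x. x \<in> H \<Longrightarrow> (\<lambda>n. b n * ip (v n) x) sums ip h x"
    using l2_series[OF v_mem bound C b] by blast
  have "(\<lambda>n. f (t n) / deriv F (t n)) sums ip f h" if f: "f \<in> H" for f
  proof -
    have "cnj (b n * ip (v n) f) = f (t n) / deriv F (t n)" for n
      using ip_cnj[OF f v_mem, of n] kn_pos[of n] by (simp add: b_def ip_v f)
    moreover have "(\<lambda>n. cnj (b n * ip (v n) f)) sums cnj (ip h f)"
      using sums[OF f] by (simp only: sums_cnj)
    ultimately show ?thesis using ip_cnj[OF h f] by simp
  qed
  then show thesis using that h by blast
qed

text \<open>Dividing \<open>F\<close> by a zero outside \<open>T\<close> would give a member of
  \<open>H\<close> vanishing on \<open>T\<close>, forcing \<open>F = 0\<close>.\<close>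

lemma F_zeros: "F z = 0 \<longleftrightarrow> z \<in> range t"
proof
  assume z: "F z = 0"
  show "z \<in> range t"
  proof (rule ccontr)
    assume nz: "z \<notin> range t"
    have mem: "divide_zero F z \<in> H"
      using divide_zero_mem[OF F_holomorphic F_zero divide_F_mem z] .
    have "divide_zero F z (t n) = 0" for n using nz F_zero[of n] by (auto simp: divide_zero_def)
    then have "divide_zero F z = 0" by (rule vanishing_on_t[OF mem])
    then have "F x = 0" for x using divide_zero_mult[of F z x] z by simp
    then have "F = (\<lambda>_. 0)" by blast
    then show False using deriv_F_nonzero[of 0] by simp
  qed
qed (auto simp: F_zero)

lemma F_nonconstant: "\<not> F constant_on UNIV"
proof
  assume "F constant_on UNIV"
  then have "F = (\<lambda>_. F (t 0))" by (metis (full_types) UNIV_I constant_on_def)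
  then have "deriv F (t 0) = 0" by (metis deriv_const)
  then show False using deriv_F_nonzero by blast
qed

text \<open>A nonconstant entire function has finitely many zeros in each disc, and injectivity of
  \<open>t\<close> turns this into finitely many indices.\<close>

lemma t_at_infinity: "filterlim (\<lambda>n. cmod (t n)) at_top sequentially"
  unfolding filterlim_at_top
proof
  fix B
  have "finite {z \<in> cball 0 B. F z = 0}"
    using holomorphic_compact_finite_zeros[OF F_holomorphic open_UNIV connected_UNIV compact_cball
        subset_UNIV F_nonconstant] .
  then have "finite (t -` {z \<in> cball 0 B. F z = 0})" by (rule finite_vimageI) (rule inj_t)
  moreover have "{n. \<not> B \<le> cmod (t n)} \<subseteq> t -` {z \<in> cball 0 B. F z = 0}" by (auto simp: F_zero)
  ultimately have "finite {n. \<not> B \<le> cmod (t n)}" by (metis finite_subset)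
  then show "\<forall>\<^sub>F n in sequentially. B \<le> cmod (t n)"
    by (simp add: eventually_cofinite flip: cofinite_eq_sequentially)
qed

text \<open>Comparing the expansions of \<open>p\<close> and of \<open>q\<close> at a single point outside \<open>T\<close> suffices.\<close>

lemma residue_sum_zero:
  assumes p: "p \<in> H" and q: "q \<in> H" and pq: "\<And>z. p z = (z - a) * q z"
  shows "(\<lambda>n. q (t n) / deriv F (t n)) sums 0"
proof -
  have "range t \<noteq> UNIV" using uncountable_UNIV_complex by (metis countable_image uncountable_def)
  then obtain x where x: "x \<notin> range t" by blast
  then have Fx: "F x \<noteq> 0" using F_zeros by blast
  have "(\<lambda>n. (x - a) * (q (t n) / deriv F (t n) * (F x / (x - t n)))
        - p (t n) / deriv F (t n) * (F x / (x - t n))) sums ((x - a) * q x - p x)"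
    by (intro sums_diff sums_mult expansion p q x)
  moreover have "(x - a) * (q (t n) / deriv F (t n) * (F x / (x - t n)))
        - p (t n) / deriv F (t n) * (F x / (x - t n)) = F x * (q (t n) / deriv F (t n))" for n
  proof -
    define r y where "r = q (t n) / deriv F (t n)" and "y = F x / (x - t n)"
    have "x - t n \<noteq> 0" using x by auto
    then have y: "F x = y * (x - t n)" by (simp add: y_def)
    have p_r: "p (t n) / deriv F (t n) = (t n - a) * r" by (simp add: pq r_def)
    show ?thesis unfolding r_def[symmetric] y_def[symmetric] p_r by (simp add: y algebra_simps)
  qed
  ultimately have "(\<lambda>n. F x * (q (t n) / deriv F (t n))) sums 0" by (simp add: pq)
  then show ?thesis using sums_mult_D[of "F x" _ 0] Fx by fastforce
qed

text \<open>Shows that the zeros left after removing \<open>t m\<close> from \<open>F\<close> are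
  still simple.\<close>

lemma deriv_divide_F:
  assumes "t n \<noteq> t m"
  shows "deriv (divide_zero F (t m)) (t n) = deriv F (t n) / (t n - t m)"
proof -
  have F_eq: "F = (\<lambda>z. divide_zero F (t m) z * (z - t m))"
    using divide_zero_mult[of F "t m"] F_zero by auto
  have zero: "divide_zero F (t m) (t n) = 0" using assms F_zero by (simp add: divide_zero_def)
  have "((\<lambda>z. divide_zero F (t m) z * (z - t m)) has_field_derivative
      deriv (divide_zero F (t m)) (t n) * (t n - t m) + 1 * divide_zero F (t m) (t n)) (at (t n))"
    using entire[OF divide_F_mem]
    by (intro DERIV_mult holomorphic_derivI[of _ UNIV]) (auto intro!: derivative_eq_intros)
  then have "deriv F (t n) = deriv (divide_zero F (t m)) (t n) * (t n - t m)"
    unfolding F_eq[symmetric] by (simp add: zero DERIV_imp_deriv)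
  then show ?thesis using assms by simp
qed

section \<open>Construction of the sparse function \<open>G\<close>\<close>

text \<open>Here \<open>G (t n) / F' (t n)\<close> has modulus \<open>sqrt b_n\<close> on the sparse set \<open>N\<close>, so that \<open>G\<close> is not
  in \<open>H\<close>, and the large coefficient \<open>s\<close> at \<open>t 1\<close> keeps \<open>\<bar>z G(z) / F(z)\<bar>\<close> away from 0 on the
  circles.\<close>

lemma sparse_generating_function:
  assumes h: "h \<in> H" and res: "\<And>f. f \<in> H \<Longrightarrow> (\<lambda>n. f (t n) / deriv F (t n)) sums ip f h"
  obtains G g N s where
    "infinite N" "infinite (- N)" "1 \<notin> N" "s > 0"
    "g \<in> H" "\<And>z. G z = (z - t 0) * g z" "ip g h = 0"
    "\<And>n. G (t n) = (if n = 1 then of_real s else if n \<in> N then of_real (kn n / cmod (deriv F (t n))) else 0)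
       * deriv F (t n)"
    "\<And>z. G z = 0 \<Longrightarrow> deriv G z \<noteq> 0"
    "summable (\<lambda>n. if n \<in> N then kn n / cmod (deriv F (t n)) else 0)"
    "8 * (\<Sum>n. if n \<in> N then kn n / cmod (deriv F (t n)) else 0) < s"
    "\<And>B :: real. \<exists>R>B. \<forall>z. cmod z = R \<longrightarrow> z \<notin> range t \<and> (\<forall>n\<in>N. cmod z \<le> 2 * cmod (z - t n))"
proof -
  define \<beta> where "\<beta> = (\<lambda>n. kn n / cmod (deriv F (t n)))"
  have \<beta>_pos: "\<beta> n > 0" for n using kn_pos[of n] deriv_F_nonzero[of n] by (simp add: \<beta>_def)
  have "summable (\<lambda>n. (\<beta> n)\<^sup>2)"
    using weights by (simp add: weight_def[abs_def] kn_def \<beta>_def power_divide)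
  then have "(\<lambda>n. (\<beta> n)\<^sup>2) \<longlonglongrightarrow> 0" by (rule summable_LIMSEQ_zero)
  then have "(\<lambda>n. sqrt ((\<beta> n)\<^sup>2)) \<longlonglongrightarrow> sqrt 0" by (rule tendsto_real_sqrt)
  then have \<beta>_lim: "\<beta> \<longlonglongrightarrow> 0" using \<beta>_pos by (simp add: less_imp_le)
  \<comment> \<open>Starting at 2 reserves index 0 for a known zero of \<open>G\<close> and index 1
    for the exceptional coefficient.\<close>
  obtain N where N: "infinite N" "infinite (- N)" and N01: "N \<inter> {..<2} = {}"
    and sum\<beta>: "summable (\<lambda>n. if n \<in> N then \<bar>\<beta> n\<bar> else 0)"
    and suma: "summable (\<lambda>n. if n \<in> N then 1 / (cmod (t n - t 0))\<^sup>2 else 0)"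
    and circles: "\<And>B :: real. \<exists>R>B. \<forall>z. cmod z = R \<longrightarrow>
        z \<notin> range t \<and> (\<forall>n\<in>N. cmod z \<le> 2 * cmod (z - t n))"
    by (rule lacunary_support[OF t_at_infinity \<beta>_lim, of 2 "t 0"]) blast
  have not01: "0 \<notin> N" "1 \<notin> N" using N01 by auto
  have t_eq: "t n = t m \<longleftrightarrow> n = m" for n m using inj_t by (simp add: inj_eq)
  \<comment> \<open>Chosen so that \<open>(t n - t 0) * u (t n)\<close> equals
    \<open>\<beta> n * deriv F (t n)\<close> on \<open>N\<close>; the modulus is
    \<open>1 / cmod (t n - t 0)\<close>, which is square-summable over \<open>N\<close>.\<close>
  define a where "a = (\<lambda>n. if n \<in> N
      then deriv F (t n) / complex_of_real (kn n) * (complex_of_real (\<beta> n) / (t n - t 0)) else 0)"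
  have "(cmod (a n))\<^sup>2 = (if n \<in> N then 1 / (cmod (t n - t 0))\<^sup>2 else 0)" for n
    using kn_pos[of n] deriv_F_nonzero[of n]
    by (simp add: a_def \<beta>_def norm_mult norm_divide power_divide)
  then have "summable (\<lambda>n. (cmod (a n))\<^sup>2)" using suma by simp
  then obtain u where u: "u \<in> H" and ut: "\<And>n. u (t n) = a n * complex_of_real (kn n)"
    using l2_interpolation by metis
  define F0 F1 where "F0 = divide_zero F (t 0)" and "F1 = divide_zero F (t 1)"
  have F01: "F0 \<in> H" "F1 \<in> H" by (simp_all add: F0_def F1_def divide_F_mem)
  have F0t: "F0 (t n) = (if n = 0 then deriv F (t n) else 0)" for n
    by (simp add: F0_def divide_zero_def F_zero t_eq)
  have F1t: "F1 (t n) = (if n = 1 then deriv F (t n) else 0)" for n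
    by (simp add: F1_def divide_zero_def F_zero t_eq)
  have "(\<lambda>n. F0 (t n) / deriv F (t n)) = (\<lambda>n. if n = 0 then 1 else 0)"
    by (auto simp: F0t deriv_F_nonzero)
  then have F0h: "ip F0 h = 1"
    using sums_unique2[OF res[OF F01(1)]] sums_single[of 0 "\<lambda>_. 1 :: complex"] by simp
  \<comment> \<open>The correction enforces orthogonality to \<open>h\<close>. On \<open>T\<close>
    it alters only the value at \<open>t 0\<close>, which the factor \<open>z - t 0\<close> in
    \<open>K\<close> annihilates.\<close>
  define gK where "gK = u - fscale (ip u h) F0"
  have gK: "gK \<in> H" unfolding gK_def by (intro diff_mem scale_mem u F01)
  have gKh: "ip gK h = 0"
    using u F01 h F0h by (simp add: gK_def ip_diff ip_scale scale_mem)
  define K where "K = (\<lambda>z. (z - t 0) * gK z)"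
  have K: "K holomorphic_on UNIV" unfolding K_def by (intro holomorphic_intros entire gK)
  have Kt: "K (t n) = (if n \<in> N then of_real (\<beta> n) else 0) * deriv F (t n)" for n
    using kn_nonzero[of n] not01
    by (cases "n = 0") (auto simp: K_def gK_def fscale_def F0t ut a_def t_eq)
  define q where "q = divide_zero F1 (t 0)"
  have F1_0: "F1 (t 0) = 0" by (simp add: F1t)
  have q: "q \<in> H" unfolding q_def by (intro A2 F01 F1_0)
  have F1q: "F1 z = (z - t 0) * q z" for z
    using divide_zero_mult[of F1 "t 0", OF F1_0] by (simp add: q_def mult.commute)
  \<comment> \<open>Both \<open>q\<close> and \<open>(z - t 0) * q = F1\<close> lie in
    \<open>H\<close>, so the residues of \<open>q\<close> sum to 0.\<close>
  have qh: "ip q h = 0"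
    using residue_sum_zero[OF F01(2) q F1q] res[OF q] by (rule sums_unique2[symmetric])
  have F1_zeros: "z \<in> range t - {t 1}" if "F1 z = 0" for z
  proof -
    have "z \<noteq> t 1" using that deriv_F_nonzero[of 1] by (auto simp: F1_def divide_zero_def)
    moreover have "F z = 0" using that divide_zero_mult[of F "t 1" z] F_zero by (simp add: F1_def)
    ultimately show ?thesis using F_zeros by blast
  qed
  have F1_simple: "deriv F1 z \<noteq> 0" if "F1 z = 0" for z
    using F1_zeros[OF that] deriv_F_nonzero by (auto simp: F1_def deriv_divide_F)
  obtain n where n: "n \<in> N" using N by (metis finite.emptyI ex_in_conv)
  then have n1: "n \<noteq> 1" using not01 by blast
  \<comment> \<open>For \<open>n\<close> in \<open>N\<close> the left side vanishes, while
    \<open>K (t n)\<close> and the derivative of \<open>F1\<close> do not: the Wronskian is not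
    identically zero.\<close>
  have "deriv K (t n) * F1 (t n) \<noteq> K (t n) * deriv F1 (t n)"
    using n n1 F1_simple[of "t n"] deriv_F_nonzero[of n] \<beta>_pos[of n] by (simp add: F1t Kt)
  \<comment> \<open>The factor 8 lets the coefficient at \<open>t 1\<close> dominate the sum over
    \<open>N\<close> on the circles, despite the factors 2 lost in the distance estimates.\<close>
  then obtain s where s: "s > max 0 (8 * (\<Sum>n. if n \<in> N then \<beta> n else 0))"
    and simple: "\<And>z. K z + of_real s * F1 z = 0 \<Longrightarrow> deriv K z + of_real s * deriv F1 z \<noteq> 0"
    using simple_zeros_pencil[OF K entire[OF F01(2)] F1_simple] by blast
  define g where "g = gK + fscale (of_real s) q"
  define G where "G = (\<lambda>z. K z + of_real s * F1 z)"
  show thesis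
  proof (rule that[of N s g G])
    show "g \<in> H" unfolding g_def by (intro add_mem scale_mem gK q)
    show "G z = (z - t 0) * g z" for z
      by (simp add: G_def g_def K_def F1q fscale_def algebra_simps)
    show "ip g h = 0" using gK q h gKh qh by (simp add: g_def ip_add ip_scale scale_mem)
    show "G (t n) = (if n = 1 then of_real s else if n \<in> N
        then of_real (kn n / cmod (deriv F (t n))) else 0) * deriv F (t n)" for n
      using not01 by (auto simp: G_def Kt F1t \<beta>_def)
    show "deriv G z \<noteq> 0" if "G z = 0" for z
    proof -
      have "(G has_field_derivative deriv K z + of_real s * deriv F1 z) (at z)"
        unfolding G_def
        by (intro DERIV_add DERIV_cmult holomorphic_derivI[OF K open_UNIV]
            holomorphic_derivI[OF entire[OF F01(2)] open_UNIV] UNIV_I)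
      then have "deriv G z = deriv K z + of_real s * deriv F1 z" by (rule DERIV_imp_deriv)
      then show ?thesis using simple[of z] that by (simp add: G_def)
    qed
    have "\<bar>\<beta> n\<bar> = kn n / cmod (deriv F (t n))" for n
      using abs_of_pos[OF \<beta>_pos] by (simp add: \<beta>_def)
    then show "summable (\<lambda>n. if n \<in> N then kn n / cmod (deriv F (t n)) else 0)"
      using sum\<beta> by (simp only:)
    show "8 * (\<Sum>n. if n \<in> N then kn n / cmod (deriv F (t n)) else 0) < s"
      using s unfolding \<beta>_def by simp
  qed (use N not01 s circles in auto)
qed

text \<open>Writing \<open>x - a = (x - t n) + (t n - a)\<close> in the expansion of
  \<open>g\<close> leaves an extra constant, the sum of the residues of \<open>g\<close>, which is
  0.\<close>

lemma expansion_multiple: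
  assumes g: "g \<in> H" and G: "\<And>z. G z = (z - a) * g z"
    and res: "(\<lambda>n. g (t n) / deriv F (t n)) sums 0" and x: "x \<notin> range t"
  shows "(\<lambda>n. G (t n) / deriv F (t n) / (x - t n)) sums (G x / F x)"
proof -
  have Fx: "F x \<noteq> 0" using F_zeros x by blast
  have "(\<lambda>n. ((x - a) * (g (t n) / deriv F (t n) * (F x / (x - t n)))
        - F x * (g (t n) / deriv F (t n))) / F x) sums (((x - a) * g x - F x * 0) / F x)"
    by (intro sums_diff sums_mult sums_divide expansion g res x)
  moreover have "((x - a) * (g (t n) / deriv F (t n) * (F x / (x - t n)))
        - F x * (g (t n) / deriv F (t n))) / F x = G (t n) / deriv F (t n) / (x - t n)" for n
  proof -
    define r y where "r = g (t n) / deriv F (t n)" and "y = F x / (x - t n)"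
    have nz: "x - t n \<noteq> 0" using x by auto
    then have y: "F x = y * (x - t n)" by (simp add: y_def)
    then have ynz: "y \<noteq> 0" using Fx by auto
    have G_r: "G (t n) / deriv F (t n) = (t n - a) * r" by (simp add: G r_def)
    have "(x - a) * (r * y) - F x * r = y * ((t n - a) * r)" by (simp add: y algebra_simps)
    then show ?thesis
      unfolding r_def[symmetric] y_def[symmetric] G_r using nz ynz by (simp add: y)
  qed
  ultimately show ?thesis by (simp add: G)
qed

lemma expansion_quotient:
  assumes f: "f \<in> H" and x: "x \<notin> range t"
  shows "(\<lambda>n. f (t n) / deriv F (t n) / (x - t n)) sums (f x / F x)"
proof -
  have "F x \<noteq> 0" using F_zeros x by blast
  then show ?thesis using sums_divide[OF expansion[OF f x], of "F x"] by simp
qed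

section \<open>Exactness of the kernels at the zeros of \<open>G\<close>, and incompleteness of the
  biorthogonal system\<close>

lemma exact_system_incomplete_biorthogonal:
  "\<exists>(l :: nat \<Rightarrow> complex) w.
     exact_system H ip (\<lambda>n. rep_kernel H ip (l n)) \<and>
     biorthogonal H ip (\<lambda>n. rep_kernel H ip (l n)) w \<and>
     \<not> complete_system H ip (range w)"
proof -
  obtain h where h: "h \<in> H" and res: "\<And>f. f \<in> H \<Longrightarrow> (\<lambda>n. f (t n) / deriv F (t n)) sums ip f h"
    using residue_functional by blast
  obtain G g N s where N: "infinite N" "infinite (- N)" "1 \<notin> N" and s: "s > 0"
    and g: "g \<in> H" and Gg: "\<And>z. G z = (z - t 0) * g z" and gh: "ip g h = 0"
    and Gt: "\<And>n. G (t n) = (if n = 1 then of_real s else if n \<in> N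
        then of_real (kn n / cmod (deriv F (t n))) else 0) * deriv F (t n)"
    and simple: "\<And>z. G z = 0 \<Longrightarrow> deriv G z \<noteq> 0"
    and sum\<beta>: "summable (\<lambda>n. if n \<in> N then kn n / cmod (deriv F (t n)) else 0)"
    and s_large: "8 * (\<Sum>n. if n \<in> N then kn n / cmod (deriv F (t n)) else 0) < s"
    and circles: "\<And>B :: real. \<exists>R>B. \<forall>z. cmod z = R \<longrightarrow>
        z \<notin> range t \<and> (\<forall>n\<in>N. cmod z \<le> 2 * cmod (z - t n))"
    by (rule sparse_generating_function[OF h], erule res, rule that)
  have G: "G holomorphic_on UNIV"
  proof -
    have "G = (\<lambda>z. (z - t 0) * g z)" using Gg by blast
    then show ?thesis using entire[OF g] by (simp add: holomorphic_intros)
  qed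
  define L where "L = {z. G z = 0}"
  have G1: "G (t 1) \<noteq> 0" and G0: "G (t 0) = 0"
    using s deriv_F_nonzero[of 1] Gt[of 1] by (simp_all add: Gg[of "t 0"])
  have "\<not> G constant_on UNIV" using G0 G1 by (metis UNIV_I constant_on_def)
  then have countable_L: "countable L" unfolding L_def by (rule entire_countable_zeros[OF G])
  have t_L: "t n \<in> L" if "n \<notin> N" "n \<noteq> 1" for n using that by (simp add: L_def Gt)
  \<comment> \<open>\<open>G\<close> vanishes at every \<open>t n\<close> with \<open>n\<close>
    outside \<open>N\<close> and different from 1, so its zeros can be enumerated without repetition
    by all natural numbers.\<close>
  have "infinite (t ` (- N - {1}))"
    using N inj_t by (simp add: finite_image_iff inj_on_subset)
  moreover have "t ` (- N - {1}) \<subseteq> L" using t_L by auto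
  ultimately have "infinite L" using finite_subset by blast
  define l where "l = from_nat_into L"
  have bij: "bij_betw l UNIV L"
    unfolding l_def using countable_L \<open>infinite L\<close> by (rule bij_betw_from_nat_into)
  have l_L: "G (l n) = 0" for n using bij unfolding L_def bij_betw_def by auto
  have l_eq: "l n = l m \<longleftrightarrow> n = m" for n m using bij by (simp add: bij_betw_def inj_eq)
  have L_l: "\<exists>n. z = l n" if "G z = 0" for z using bij that unfolding bij_betw_def L_def by blast

  have dz0: "divide_zero G (t 0) = g" using divide_zero_eqI[OF entire[OF g]] Gg by blast
  have mem: "divide_zero G z \<in> H" if "G z = 0" for z
    using divide_zero_mem[OF G G0 _ that] g dz0 by simp
  have ker: "ip (divide_zero G z) h = 0" if z: "G z = 0" for z
  proof (cases "z = t 0")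
    case False
    then have gz: "g z = 0" using z by (simp add: Gg)
    \<comment> \<open>The quotient at \<open>z\<close> is \<open>g\<close> plus a multiple of
      \<open>q\<close>; since \<open>g = (x - z) * q\<close> is in \<open>H\<close>, the residue sum
      of \<open>q\<close> vanishes.\<close>
    define q where "q = divide_zero g z"
    have q: "q \<in> H" unfolding q_def by (intro A2 g gz)
    have "g x = (x - z) * q x" for x
      using divide_zero_mult[of g z, OF gz] by (simp add: q_def mult.commute)
    then have "ip q h = 0" using residue_sum_zero[OF g q] res[OF q] sums_unique2 by metis
    moreover have "divide_zero G z = g + fscale (z - t 0) q"
      using divide_zero_shift[OF G G0 z] False by (simp add: dz0 q_def)
    ultimately show ?thesis using g q h gh by (simp add: ip_add ip_scale scale_mem)
  qed (simp add: dz0 gh)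

  define w' where "w' = (\<lambda>n. fscale (1 / deriv G (l n)) (divide_zero G (l n)))"
  have w': "w' n \<in> H" for n unfolding w'_def by (intro scale_mem mem l_L)
  have bio: "biorthogonal H ip (\<lambda>n. rep_kernel H ip (l n)) w'"
  proof -
    have "w' m (l n) = (if n = m then 1 else 0)" for n m
      using l_L simple by (simp add: w'_def fscale_def divide_zero_def l_eq)
    then show ?thesis
      unfolding biorthogonal_def using w' rep_kernel_mem by (auto simp: rep_kernel_ip)
  qed
  have incomplete: "\<not> complete_system H ip (range w')"
  proof
    assume complete: "complete_system H ip (range w')"
    have "h = 0"
    proof (rule complete_system_orthogonal[OF complete h])
      fix f assume "f \<in> range w'"
      then show "ip f h = 0" using mem[OF l_L] ker[OF l_L] h by (auto simp: w'_def ip_scale)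
    qed
    \<comment> \<open>The functional takes the value 1 on \<open>F / (z - t 0)\<close>, so
      \<open>h\<close> cannot be 0.\<close>
    then have "(\<lambda>n. divide_zero F (t 0) (t n) / deriv F (t n)) sums 0"
      using res[OF divide_F_mem, of 0] by (simp add: ip_zero_right divide_F_mem)
    moreover have "(\<lambda>n. divide_zero F (t 0) (t n) / deriv F (t n)) = (\<lambda>n. if n = 0 then 1 else 0)"
      using inj_t by (auto simp: divide_zero_def F_zero deriv_F_nonzero inj_eq)
    ultimately show False using sums_unique2 sums_single[of 0 "\<lambda>_. 1 :: complex"] by fastforce
  qed

  have unique: "f = 0" if f: "f \<in> H" and zero: "\<And>z. G z = 0 \<Longrightarrow> f z = 0" for f
  proof -
    have "deriv G z \<noteq> 0 \<and> f z = 0" if "G z = 0" for z using simple zero that by blast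
    from entire_quotient[OF entire[OF f] G this]
    obtain E where E: "E holomorphic_on UNIV" and fE: "\<And>z. f z = E z * G z" by blast
    define d where "d = (\<lambda>n. f (t n) / deriv F (t n))"
    define \<beta> where "\<beta> = (\<lambda>n. complex_of_real (if n \<in> N then kn n / cmod (deriv F (t n)) else 0))"
    define D where "D = (\<Sum>n. cmod (d n))"
    define S where "S = (\<Sum>n. cmod (\<beta> n))"
    have \<beta>_norm: "cmod (\<beta> n) = (if n \<in> N then kn n / cmod (deriv F (t n)) else 0)" for n
      using kn_pos[of n] by (simp add: \<beta>_def)
    have sum_d: "summable (\<lambda>n. cmod (d n))" unfolding d_def by (rule summable_residues[OF f])
    have sum_\<beta>: "summable (\<lambda>n. cmod (\<beta> n))" using sum\<beta> by (simp add: \<beta>_norm)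
    have S: "8 * S < s" using s_large by (simp add: S_def \<beta>_norm)
    \<comment> \<open>The remaining \<open>t n\<close> are zeros of \<open>G\<close>, hence of
      \<open>f\<close>; so the coefficients of \<open>f / F\<close> are also supported on
      \<open>N\<close> and 1, and the circle estimates apply.\<close>
    have d0: "d n = 0" if "n \<notin> N" "n \<noteq> 1" for n
      using zero[of "t n"] t_L[OF that] by (simp add: d_def L_def)
    have "\<exists>R>B. \<forall>z. cmod z = R \<longrightarrow> cmod (E z) \<le> 8 * D / s" for B
    proof -
      \<comment> \<open>Exceeding \<open>2 * cmod (t 1)\<close> makes the distance estimate hold for
        the exceptional point too.\<close>
      obtain R where R: "R > max B (2 * cmod (t 1))"
        and circle: "\<And>z. cmod z = R \<Longrightarrow> z \<notin> range t \<and> (\<forall>n\<in>N. cmod z \<le> 2 * cmod (z - t n))"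
        using circles by blast
      have "cmod (E z) \<le> 8 * D / s" if z: "cmod z = R" for z
      proof -
        have zT: "z \<notin> range t" and zN: "\<And>n. n \<in> N \<Longrightarrow> cmod z \<le> 2 * cmod (z - t n)"
          using circle[OF z] by auto
        have z_t1: "cmod z \<le> 2 * cmod (z - t 1)" "cmod (z - t 1) \<le> 2 * cmod z"
          using R z norm_triangle_ineq2[of z "t 1"] norm_triangle_ineq4[of z "t 1"] by linarith+
        have z_ne: "z \<noteq> t n" for n using zT by auto
        have upper: "cmod z * cmod (f z / F z) \<le> 2 * D"
          unfolding D_def
        proof (rule cauchy_sum_bound[OF sum_d])
          show "(\<lambda>n. d n / (z - t n)) sums (f z / F z)"
            unfolding d_def by (rule expansion_quotient[OF f zT])
          show "z \<noteq> t n \<and> cmod z \<le> 2 * cmod (z - t n)" if "d n \<noteq> 0" for n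
            using d0[of n] that zN[of n] z_t1 z_ne by (cases "n = 1") auto
        qed
        have "(\<lambda>n. G (t n) / deriv F (t n) / (z - t n)) sums (G z / F z)"
          using expansion_multiple[OF g Gg _ zT] res[OF g] gh by simp
        \<comment> \<open>Removing the term at \<open>t 1\<close> leaves the small sum over
          \<open>N\<close>.\<close>
        from sums_diff[OF this sums_single[of 1 "\<lambda>n. of_real s / (z - t n)"]]
        have "(\<lambda>n. G (t n) / deriv F (t n) / (z - t n) - (if n = 1 then of_real s / (z - t n) else 0))
            sums (G z / F z - of_real s / (z - t 1))" .
        moreover have "G (t n) / deriv F (t n) / (z - t n) - (if n = 1 then of_real s / (z - t n) else 0)
            = \<beta> n / (z - t n)" for n
          using N(3) deriv_F_nonzero[of n] by (auto simp: Gt \<beta>_def)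
        ultimately have sums_\<beta>: "(\<lambda>n. \<beta> n / (z - t n)) sums (G z / F z - of_real s / (z - t 1))"
          by simp
        have rest: "cmod z * cmod (G z / F z - of_real s / (z - t 1)) \<le> 2 * S"
          unfolding S_def
          by (rule cauchy_sum_bound[OF sum_\<beta> sums_\<beta>]) (use zN z_ne in \<open>auto simp: \<beta>_def split: if_splits\<close>)
        have "s / 2 \<le> cmod z * cmod (of_real s / (z - t 1))"
          using z_t1(2) z_ne[of 1] s by (simp add: norm_divide field_simps)
        also have "\<dots> \<le> cmod z * (cmod (G z / F z) + cmod (G z / F z - of_real s / (z - t 1)))"
          using norm_triangle_ineq4[of "G z / F z" "G z / F z - of_real s / (z - t 1)"]
          by (intro mult_left_mono) auto
        \<comment> \<open>The main term contributes at least \<open>s / 2\<close>, and the rest at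
          most \<open>2 * S < s / 4\<close>.\<close>
        finally have lower: "s / 4 \<le> cmod z * cmod (G z / F z)"
          using rest S by (simp add: algebra_simps)
        have "s / 4 * cmod (E z) \<le> cmod z * cmod (G z / F z) * cmod (E z)"
          using lower by (rule mult_right_mono) simp
        also have "\<dots> = cmod z * cmod (f z / F z)"
          by (simp add: fE norm_mult norm_divide)
        also note upper
        finally show ?thesis using s by (simp add: field_simps)
      qed
      then show ?thesis using R by (intro exI[of _ R]) auto
    qed
    then have "E constant_on UNIV" using bounded_on_circles_constant[OF E] by blast
    then obtain e where e: "\<And>z. E z = e" by (auto simp: constant_on_def)
    \<comment> \<open>If \<open>f = e * G\<close>, the normalized values of \<open>f\<close> have
      constant modulus \<open>cmod e\<close> along the infinite set \<open>N\<close>, yet they tend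
      to 0; thus \<open>e = 0\<close>.\<close>
    have "(\<lambda>n. (cmod (f (t n) / complex_of_real (kn n)))\<^sup>2) \<longlonglongrightarrow> 0"
      using l2_values[OF f] by (rule summable_LIMSEQ_zero)
    moreover have "(cmod (f (t n) / complex_of_real (kn n)))\<^sup>2 = (cmod e)\<^sup>2" if "n \<in> N" for n
      using that N(3) kn_pos[of n] deriv_F_nonzero[of n]
      by (auto simp: fE e Gt norm_mult norm_divide)
    ultimately have "(cmod e)\<^sup>2 = 0"
    proof -
      assume lim: "(\<lambda>n. (cmod (f (t n) / complex_of_real (kn n)))\<^sup>2) \<longlonglongrightarrow> 0"
        and const: "\<And>n. n \<in> N \<Longrightarrow> (cmod (f (t n) / complex_of_real (kn n)))\<^sup>2 = (cmod e)\<^sup>2"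
      have "(\<lambda>k. (cmod (f (t (enumerate N k)) / complex_of_real (kn (enumerate N k))))\<^sup>2) \<longlonglongrightarrow> 0"
        using LIMSEQ_subseq_LIMSEQ[OF lim strict_mono_enumerate[OF N(1)]] by (simp add: o_def)
      then show ?thesis
        using const[OF enumerate_in_set[OF N(1)]] by (simp add: LIMSEQ_const_iff)
    qed
    then show "f = 0" by (auto simp: fE e fun_eq_iff)
  qed
  have rk: "range (\<lambda>n. rep_kernel H ip (l n)) \<subseteq> H" using rep_kernel_mem by auto
  have "complete_system H ip (range (\<lambda>n. rep_kernel H ip (l n)))"
  proof (rule complete_systemI[OF rk])
    fix f assume f: "f \<in> H" and orth: "\<And>k. k \<in> range (\<lambda>n. rep_kernel H ip (l n)) \<Longrightarrow> ip k f = 0"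
    have "f (l n) = 0" for n using orth[of "rep_kernel H ip (l n)"] f by (simp add: rep_kernel_ip)
    then show "f = 0" using unique[OF f] L_l by metis
  qed
  moreover have "\<not> complete_system H ip ((\<lambda>n. rep_kernel H ip (l n)) ` (UNIV - {n}))" for n
  proof
    assume complete: "complete_system H ip ((\<lambda>n. rep_kernel H ip (l n)) ` (UNIV - {n}))"
    \<comment> \<open>\<open>w' n\<close> is orthogonal to all the other kernels, so completeness
      without index \<open>n\<close> would make it vanish.\<close>
    have "w' n = 0"
      by (rule complete_system_orthogonal[OF complete w'])
        (use bio in \<open>auto simp: biorthogonal_def split: if_splits\<close>)
    moreover have "ip (rep_kernel H ip (l n)) (w' n) = 1" using bio by (simp add: biorthogonal_def)
    ultimately show False using ip_zero_right[OF rep_kernel_mem] by simp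
  qed
  ultimately have "exact_system H ip (\<lambda>n. rep_kernel H ip (l n))"
    by (simp add: exact_system_def)
  then show ?thesis using bio incomplete by blast
qed

end

theorem theorem1p1:
  fixes H :: "cfun set" and ip :: cinner and t :: "nat \<Rightarrow> complex" and F :: cfun
  assumes "class_R H ip"
    and "riesz_kernel_points H ip t"
    and "generating_function H ip t F"
    and "summable (weight H ip t F)"
  shows "\<exists>(l :: nat \<Rightarrow> complex) w.
           exact_system H ip (\<lambda>n. rep_kernel H ip (l n)) \<and>
           biorthogonal H ip (\<lambda>n. rep_kernel H ip (l n)) w \<and>
           \<not> complete_system H ip (range w)"
proof -
  interpret weighted_class_R H ip t F
    using assms by (intro weighted_class_R.intro weighted_class_R_axioms.intro)
  show ?thesis by (rule exact_system_incomplete_biorthogonal)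
qed

end
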